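(* Let $G$ be a locally compact, second countable, abelian group with Haar measure $m_G$, which acts continuously on a compact space $X$. Let $\mu$ be an ergodic (Borel) probability measure on $X$, let $f \in L_\infty(X,\mu)$, and let $(F_n)$ be a tempered strong Følner sequence in $G$. Then there exists a subset $X' \subset X$ with $\mu(X')=1$ such that for all $x \in X'$ and for all $h \in G$ $$\frac{1}{m_G(F_n)} \int_{F_n} f(hgx) \overline{f(gx)}\, dm_G(g) \longrightarrow \int_X f(hy) \overline{f(y)}\, d\mu(y) = \langle T_{h^{-1}} f, f \rangle \qquad (n \to \infty).$$
   Context: The compact topological space $X$ carries its Borel $\sigma$-algebra; $gx$ denotes the action of $g \in G$ on $x \in X$. A $G$-invariant measure $\mu$ on $X$ is ergodic if every measurable set $B$ with $\mu(gB \Delta B)=0$ for all $g \in G$ satisfies $\mu(B) \in \{0,1\}$. For $g \in G$, $T_g$ is the unitary operator on $L_2(X,\mu)$ given by $T_g f(x) = f(g^{-1}x)$, and $\langle u, v\rangle = \int_X u \overline{v}\, d\mu$. A sequence $(F_n)$ of nonempty compact subsets of $G$ (with $m_G(F_n)>0$) is a strong Følner sequence if $m_G(\partial_K(F_n))/m_G(F_n) \to 0$ as $n \to \infty$ for every compact $K \subset G$, where $$\partial_K(F) = \{ g \in G : Kg \cap F \neq \emptyset \text{ and } Kg \cap (G \setminus F) \neq \emptyset\}.$$ It is tempered if there exists $C>0$ such that $m_G\left(\bigcup_{k<n} F_k^{-1}F_n\right) \le C\, m_G(F_n)$ for all $n \in \mathbb{N}$. *)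

theory Defs
  imports "HOL-Analysis.Analysis" "HOL-Probability.Probability"
begin

text \<open>
  The abelian group is written additively, so that the library class
  \<^class>\<open>topological_ab_group_add\<close> applies: the products \<open>g h\<close>, \<open>g\<^sup>-\<^sup>1\<close>, \<open>K g\<close> and
  \<open>A\<^sup>-\<^sup>1 B\<close> become \<open>g + h\<close>, \<open>- g\<close>, \<open>K + g\<close> and \<open>- A + B\<close>.
\<close>

definition haar_measure :: "'g::topological_ab_group_add measure \<Rightarrow> bool" where
  "haar_measure m \<longleftrightarrow>
     sets m = sets borel \<and>
     emeasure m UNIV \<noteq> 0 \<and>
     (\<forall>K. compact K \<longrightarrow> emeasure m K < \<infinity>) \<and>
     (\<forall>g. \<forall>A\<in>sets borel. emeasure m ((+) g ` A) = emeasure m A) \<and>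
     (\<forall>A\<in>sets borel. emeasure m A = (INF U\<in>{U. open U \<and> A \<subseteq> U}. emeasure m U)) \<and>
     (\<forall>U. open U \<longrightarrow> emeasure m U = (SUP K\<in>{K. compact K \<and> K \<subseteq> U}. emeasure m K))"

definition continuous_action ::
  "('g::topological_ab_group_add \<Rightarrow> 'x::topological_space \<Rightarrow> 'x) \<Rightarrow> bool" where
  "continuous_action act \<longleftrightarrow>
     (\<forall>x. act 0 x = x) \<and>
     (\<forall>g h x. act (g + h) x = act g (act h x)) \<and>
     continuous_on UNIV (\<lambda>(g, x). act g x)"

definition invariant_measure :: "('g \<Rightarrow> 'x \<Rightarrow> 'x) \<Rightarrow> 'x measure \<Rightarrow> bool" where
  "invariant_measure act M \<longleftrightarrow>
     (\<forall>g. \<forall>B\<in>sets M. emeasure M (act g ` B) = emeasure M B)"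

definition ergodic_measure :: "('g \<Rightarrow> 'x \<Rightarrow> 'x) \<Rightarrow> 'x measure \<Rightarrow> bool" where
  "ergodic_measure act M \<longleftrightarrow>
     invariant_measure act M \<and>
     (\<forall>B\<in>sets M. (\<forall>g. emeasure M (sym_diff (act g ` B) B) = 0) \<longrightarrow>
        emeasure M B \<in> {0, 1})"

text \<open>
  Elements of \<open>L\<^sub>\<infinity>\<close> and \<open>L\<^sub>2\<close> are given by representatives: Borel functions that need only be
  essentially bounded, with no identification of functions that agree almost everywhere.
\<close>

definition L_infinity :: "'x measure \<Rightarrow> ('x \<Rightarrow> complex) set" where
  "L_infinity M = {f \<in> borel_measurable M. esssup M (\<lambda>x. ereal (cmod (f x))) < \<infinity>}"

definition koopman ::
  "('g::group_add \<Rightarrow> 'x \<Rightarrow> 'x) \<Rightarrow> 'g \<Rightarrow> ('x \<Rightarrow> complex) \<Rightarrow> 'x \<Rightarrow> complex" where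
  "koopman act g f = (\<lambda>x. f (act (- g) x))"

definition L2_inner :: "'x measure \<Rightarrow> ('x \<Rightarrow> complex) \<Rightarrow> ('x \<Rightarrow> complex) \<Rightarrow> complex" where
  "L2_inner M u v = (LINT x|M. u x * cnj (v x))"

definition boundary :: "'g::group_add set \<Rightarrow> 'g set \<Rightarrow> 'g set" where
  "boundary K F =
     {g. (\<lambda>k. k + g) ` K \<inter> F \<noteq> {} \<and> (\<lambda>k. k + g) ` K \<inter> (UNIV - F) \<noteq> {}}"

text \<open>
  For compact \<open>K\<close> and \<open>F\<close> the set \<open>boundary K F\<close> is the intersection of the compact set
  \<open>- K + F\<close> with the open set \<open>- K + (UNIV - F)\<close>, hence Borel of finite Haar measure; the
  sets in the temperedness condition are compact. So the real-valued \<^const>\<open>measure\<close> is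
  adequate in both definitions below.
\<close>

definition strong_folner_sequence ::
  "'g::topological_ab_group_add measure \<Rightarrow> (nat \<Rightarrow> 'g set) \<Rightarrow> bool" where
  "strong_folner_sequence m F \<longleftrightarrow>
     (\<forall>n. F n \<noteq> {} \<and> compact (F n) \<and> measure m (F n) > 0) \<and>
     (\<forall>K. compact K \<longrightarrow>
        (\<lambda>n. measure m (boundary K (F n)) / measure m (F n)) \<longlonglongrightarrow> 0)"

definition tempered :: "'g::group_add measure \<Rightarrow> (nat \<Rightarrow> 'g set) \<Rightarrow> bool" where
  "tempered m F \<longleftrightarrow>
     (\<exists>C>0. \<forall>n. measure m (\<Union>k<n. {- a + b |a b. a \<in> F k \<and> b \<in> F n}) \<le> C * measure m (F n))"

end

theory Submission
  imports Defs
begin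

text \<open>
  A maximal inequality for tempered sequences is proved on \<open>X\<close> itself by a deterministic version
  of Lindenstrauss' covering argument, in which fractional weights replace the random selection of
  translates.  With the mean ergodic theorem, obtained from nearly norm-minimal convex combinations
  of translates, it yields the pointwise ergodic theorem for bounded functions, hence the claim for
  all \<open>h\<close> in a countable dense subset of the group.  To reach every \<open>h\<close>, \<open>f\<close> is compared with its
  mean over a small neighbourhood of the identity: the mean varies uniformly continuously along
  orbits, and the averages of the error along translates are controlled by the Folner property.
\<close>

section \<open>Haar measure and the action\<close>

text \<open>The space X need not be metrizable or even Hausdorff, and the measure on it need not be
  regular. Continuous functions are therefore no usable dense class; joint measurability of the
  action and continuity of translation in mean rest on open sets and on the countable base of the
  group. The link between the two ergodic theorems is that the Folner averages of u and of a convex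
  combination w of its translates differ by a quantity tending to 0 at every point, without
  exceptional set. Thus u may be traded for a w of small L1 norm, whose averages the maximal
  inequality controls. The weights of the covering are functions on X, so invariance of the measure
  does the work usually done by transferring the problem to the group. A dense set of h does not
  settle the remaining h by itself: the continuity of the averages in h would have to be uniform in
  n, while f is only measurable.\<close>

lemma open_Times_measurable:
  fixes W :: "('g::second_countable_topology \<times> 'x::topological_space) set"
  assumes W: "open W"
  shows "W \<in> sets (borel \<Otimes>\<^sub>M borel)"
proof -
  obtain B :: "'g set set" where B: "countable B" "topological_basis B"
    using ex_countable_basis by blast
  \<comment> \<open>X may lack a countable base, so the rectangles are indexed by basic sets of the
    group alone: for each \<open>b\<close> all admissible open subsets of X are merged into a single
    open one.\<close>
  define V where "V b = \<Union>{V. open V \<and> b \<times> V \<subseteq> W}" for b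
  have "W \<subseteq> (\<Union>b\<in>B. b \<times> V b)"
  proof
    fix z assume "z \<in> W"
    then obtain S T where ST: "open S" "open T" "z \<in> S \<times> T" "S \<times> T \<subseteq> W"
      using W by (metis open_prod_def)
    then obtain b where "b \<in> B" "fst z \<in> b" "b \<subseteq> S"
      using topological_basisE[OF B(2) ST(1) mem_Times_iff[THEN iffD1, OF ST(3), THEN conjunct1]] by blast
    then have "open T \<and> b \<times> T \<subseteq> W" using ST by auto
    then have "snd z \<in> V b" using ST(3) unfolding V_def by auto
    then show "z \<in> (\<Union>b\<in>B. b \<times> V b)" using \<open>b \<in> B\<close> \<open>fst z \<in> b\<close> by (cases z) auto
  qed
  moreover have "(\<Union>b\<in>B. b \<times> V b) \<subseteq> W" unfolding V_def by auto
  ultimately have W_eq: "W = (\<Union>b\<in>B. b \<times> V b)" by (rule equalityI)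
  have "b \<times> V b \<in> sets (borel \<Otimes>\<^sub>M borel)" if "b \<in> B" for b
    using topological_basis_open[OF B(2) that] unfolding V_def
    by (intro pair_measureI borel_open open_Union) auto
  then show ?thesis unfolding W_eq by (rule sets.countable_UN''[OF B(1)])
qed

lemma plus_image: "(+) g ` B = (+) (- g) -` B" for g :: "'g::ab_group_add"
proof (intro set_eqI iffI)
  fix x assume "x \<in> (+) (- g) -` B"
  then show "x \<in> (+) g ` B" by (intro image_eqI[of _ _ "- g + x"]) auto
qed auto

locale lca_action = prob_space M
  for M :: "'x::topological_space measure" +
  fixes m :: "'g::{topological_ab_group_add, t2_space, second_countable_topology} measure"
    and act :: "'g \<Rightarrow> 'x \<Rightarrow> 'x"
  assumes locally_compact: "locally_compact_space (euclidean :: 'g topology)"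
    and haar: "haar_measure m"
    and action: "continuous_action act"
    and sets_M [measurable_cong]: "sets M = sets borel"
    and invariant: "invariant_measure act M"
begin

lemma sets_m [measurable_cong]: "sets m = sets borel"
  using haar by (simp add: haar_measure_def)

lemma space_m [simp]: "space m = UNIV"
  using sets_eq_imp_space_eq[OF sets_m] by simp

lemma space_M [simp]: "space M = UNIV"
  using sets_eq_imp_space_eq[OF sets_M] by simp

lemma act_0 [simp]: "act 0 x = x" and act_add: "act (g + h) x = act g (act h x)"
  using action by (auto simp: continuous_action_def)

lemma act_minus [simp]: "act (- g) (act g x) = x" "act g (act (- g) x) = x"
  by (simp_all flip: act_add)

lemma continuous_act: "continuous_on UNIV (\<lambda>(g, x). act g x)"
  using action by (auto simp: continuous_action_def)

text \<open>Continuity yields Borel sets of the product topology, whereas Fubini needs the product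
  of the Borel sigma-algebras, which might be smaller; \<open>open_Times_measurable\<close> closes
  this gap.\<close>

lemma measurable_act_pair [measurable]: "(\<lambda>(g, x). act g x) \<in> m \<Otimes>\<^sub>M M \<rightarrow>\<^sub>M M"
proof -
  have "(\<lambda>(g, x). act g x) \<in> measurable (borel \<Otimes>\<^sub>M borel) borel"
  proof (rule borel_measurableI)
    fix S :: "'x set" assume "open S"
    then have "open ((\<lambda>(g, x). act g x) -` S)"
      using continuous_act by (rule open_vimage)
    then show "(\<lambda>(g, x). act g x) -` S \<inter> space (borel \<Otimes>\<^sub>M borel) \<in> sets (borel \<Otimes>\<^sub>M borel)"
      using open_Times_measurable by (auto simp: space_pair_measure)
  qed
  moreover have "m \<Otimes>\<^sub>M M \<rightarrow>\<^sub>M M = borel \<Otimes>\<^sub>M borel \<rightarrow>\<^sub>M borel"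
    by (intro measurable_cong_sets sets_pair_measure_cong sets_m sets_M)
  ultimately show ?thesis by simp
qed

lemma measurable_act [measurable (raw)]:
  assumes "a \<in> N \<rightarrow>\<^sub>M m" "b \<in> N \<rightarrow>\<^sub>M M"
  shows "(\<lambda>y. act (a y) (b y)) \<in> N \<rightarrow>\<^sub>M M"
  using measurable_compose[OF measurable_Pair[OF assms] measurable_act_pair] unfolding case_prod_conv .

lemma measurable_m: "N \<rightarrow>\<^sub>M m = N \<rightarrow>\<^sub>M borel"
  by (rule measurable_cong_sets[OF refl sets_m])

lemma measurable_uminus_m [measurable (raw)]:
  assumes "a \<in> N \<rightarrow>\<^sub>M m" shows "(\<lambda>y. - a y) \<in> N \<rightarrow>\<^sub>M m"
proof -
  have "(\<lambda>g::'g. - g) \<in> borel \<rightarrow>\<^sub>M borel"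
    by (intro borel_measurable_continuous_onI continuous_intros)
  from measurable_compose[OF assms[unfolded measurable_m] this]
  show ?thesis unfolding measurable_m .
qed

lemma measurable_plus_m [measurable (raw)]:
  assumes "a \<in> N \<rightarrow>\<^sub>M m" "b \<in> N \<rightarrow>\<^sub>M m" shows "(\<lambda>y. a y + b y) \<in> N \<rightarrow>\<^sub>M m"
  using assms unfolding measurable_m by (rule borel_measurable_add)

lemma measurable_plus_left [measurable]: "(+) g \<in> m \<rightarrow>\<^sub>M m"
  by (rule measurable_plus_m) (rule measurable_const measurable_ident | simp)+

lemma emeasure_act:
  assumes [measurable]: "B \<in> sets M" shows "emeasure M (act g -` B) = emeasure M B"
proof -
  have "act g -` B = act (- g) ` B"
  proof (intro set_eqI iffI)
    fix x assume "x \<in> act g -` B"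
    then show "x \<in> act (- g) ` B" by (intro image_eqI[of _ _ "act g x"]) auto
  qed auto
  then show ?thesis using invariant assms unfolding invariant_measure_def by metis
qed

lemma distr_act: "distr M M (act g) = M"
proof (rule measure_eqI)
  fix B assume "B \<in> sets (distr M M (act g))"
  then show "emeasure (distr M M (act g)) B = emeasure M B"
    using emeasure_act[of B g] by (subst emeasure_distr) simp_all
qed simp

lemma emeasure_plus_image: "B \<in> sets m \<Longrightarrow> emeasure m ((+) g ` B) = emeasure m B"
  using haar unfolding haar_measure_def by metis

lemma distr_plus: "distr m m ((+) g) = m"
proof (rule measure_eqI)
  fix B assume "B \<in> sets (distr m m ((+) g))"
  then have B: "B \<in> sets m" by simp
  have "(+) g -` B = (+) (- g) ` B" unfolding plus_image by simp
  moreover have "emeasure m ((+) (- g) ` B) = emeasure m B"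
    using B by (rule emeasure_plus_image)
  ultimately show "emeasure (distr m m ((+) g)) B = emeasure m B"
    using B by (subst emeasure_distr) simp_all
qed simp

lemma nn_integral_act:
  "u \<in> borel_measurable M \<Longrightarrow> (\<integral>\<^sup>+x. u (act g x) \<partial>M) = (\<integral>\<^sup>+x. u x \<partial>M)"
  by (subst (2) distr_act[of g, symmetric], subst nn_integral_distr) auto

lemma integral_act:
  fixes u :: "'x \<Rightarrow> 'b::{banach, second_countable_topology}"
  shows "u \<in> borel_measurable M \<Longrightarrow> (\<integral>x. u (act g x) \<partial>M) = (\<integral>x. u x \<partial>M)"
  by (subst (2) distr_act[of g, symmetric], subst integral_distr) auto

lemma AE_act:
  assumes "AE x in M. P x" shows "AE x in M. P (act g x)"
  by (rule AE_distrD[of "act g" M M P], simp) (subst distr_act, rule assms)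

lemma nn_integral_plus:
  "u \<in> borel_measurable m \<Longrightarrow> (\<integral>\<^sup>+g. u (h + g) \<partial>m) = (\<integral>\<^sup>+g. u g \<partial>m)"
  by (subst (2) distr_plus[of h, symmetric], subst nn_integral_distr) auto

lemma integral_plus:
  fixes u :: "'g \<Rightarrow> 'b::{banach, second_countable_topology}"
  shows "u \<in> borel_measurable m \<Longrightarrow> (\<integral>g. u (h + g) \<partial>m) = (\<integral>g. u g \<partial>m)"
  by (subst (2) distr_plus[of h, symmetric], subst integral_distr) auto

lemma AE_plus:
  assumes "AE g in m. P g" shows "AE g in m. P (h + g)"
  by (rule AE_distrD[of "(+) h" m m P], simp) (subst distr_plus, rule assms)

section \<open>Haar measure of compact and open sets\<close>

lemma compact_measurable [measurable (raw)]: "compact (K::'g set) \<Longrightarrow> K \<in> sets m"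
  by (simp add: sets_m borel_compact)

lemma emeasure_compact: "compact K \<Longrightarrow> emeasure m K < \<infinity>"
  using haar by (simp add: haar_measure_def)

lemma relatively_compact_nbhd:
  obtains U K where "open U" "compact K" "(g::'g) \<in> U" "U \<subseteq> K"
proof -
  have "\<exists>U K. open U \<and> compact K \<and> g \<in> U \<and> U \<subseteq> K"
    using locally_compact unfolding locally_compact_space_def by simp
  then show ?thesis using that by blast
qed

text \<open>By Lindelof, countably many open sets contained in compact ones cover the group. This
  makes Fubini available for \<open>m\<close> and \<open>M\<close>.\<close>

sublocale G: sigma_finite_measure m
proof
  define \<U> where "\<U> = {U::'g set. open U \<and> (\<exists>K. compact K \<and> U \<subseteq> K)}"
  have op: "open U" if "U \<in> \<U>" for U using that by (simp add: \<U>_def)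
  obtain \<V> where V: "\<V> \<subseteq> \<U>" "countable \<V>" "\<Union>\<V> = \<Union>\<U>"
    by (rule Lindelof[of \<U>, OF op])
  have "\<exists>U\<in>\<U>. g \<in> U" for g
  proof -
    obtain U K where "open U" "compact K" "g \<in> U" "U \<subseteq> K" by (rule relatively_compact_nbhd)
    then show ?thesis unfolding \<U>_def by (intro bexI[of _ U]) auto
  qed
  then have un: "\<Union>\<U> = UNIV" by auto
  have fin: "emeasure m U \<noteq> \<infinity>" if U: "U \<in> \<U>" for U
  proof -
    obtain K where "compact K" "U \<subseteq> K" using U by (auto simp: \<U>_def)
    then have "emeasure m U \<le> emeasure m K" by (intro emeasure_mono) auto
    then show ?thesis using emeasure_compact[OF \<open>compact K\<close>] by (auto simp: top_unique)
  qed
  have "\<U> \<subseteq> sets m" by (auto simp: \<U>_def sets_m)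
  then show "\<exists>A. countable A \<and> A \<subseteq> sets m \<and> \<Union> A = space m \<and> (\<forall>a\<in>A. emeasure m a \<noteq> \<infinity>)"
    using V un fin by (intro exI[of _ \<V>]) (simp add: subset_iff)
qed

sublocale P: pair_sigma_finite m M ..

text \<open>Countably many translates of \<open>U\<close> cover the group, so a null
  \<open>U\<close> would make the whole group null.\<close>

lemma emeasure_open_pos:
  assumes U: "open U" "U \<noteq> {}" shows "emeasure m U \<noteq> 0"
proof
  assume 0: "emeasure m U = 0"
  obtain u where u: "u \<in> U" using U by auto
  define \<U> where "\<U> = range (\<lambda>g. (+) g ` U)"
  have op: "open ((+) g ` U)" for g
    unfolding plus_image by (rule open_vimage[OF U(1)]) (intro continuous_intros)
  then have op': "open S" if "S \<in> \<U>" for S using that by (auto simp: \<U>_def)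
  obtain \<V> where V: "\<V> \<subseteq> \<U>" "countable \<V>" "\<Union>\<V> = \<Union>\<U>"
    by (rule Lindelof[of \<U>, OF op'])
  have "g \<in> (+) (g - u) ` U" for g using u by (auto simp: image_iff intro!: bexI[of _ u])
  then have un: "\<Union>\<V> = UNIV" using V(3) unfolding \<U>_def by blast
  have "A \<in> null_sets m" if A: "A \<in> \<U>" for A
  proof -
    obtain g where g: "A = (+) g ` U" using A by (auto simp: \<U>_def)
    then have "emeasure m A = 0"
      using 0 emeasure_plus_image[of U g] U(1) by (simp add: sets_m)
    then show ?thesis using op[of g] g by (auto simp: null_sets_def sets_m)
  qed
  then have "(\<Union>A\<in>\<V>. A) \<in> null_sets m" using V(1,2) by (intro null_sets_UN') auto
  then have "emeasure m UNIV = 0" using un by auto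
  then show False using haar unfolding haar_measure_def by blast
qed

end

section \<open>The maximal inequality\<close>

text \<open>The covering weights are defined from level \<open>N\<close> downwards, each from the
  levels strictly above it. Since \<open>H n\<close> sees only those levels, overwriting a lower
  value preserves the equations already established.\<close>

lemma downward_recursion:
  fixes H :: "nat \<Rightarrow> (nat \<Rightarrow> 'a) \<Rightarrow> 'a"
  assumes H: "\<And>n w w'. (\<And>k. n < k \<Longrightarrow> k \<le> N \<Longrightarrow> w k = w' k) \<Longrightarrow> H n w = H n w'"
  shows "\<exists>w. \<forall>n\<le>N. w n = H n w"
proof -
  have "\<exists>w. \<forall>n\<le>N. N < n + j \<longrightarrow> w n = H n w" for j
  proof (induction j)
    case (Suc j)
    then obtain w where w: "\<And>n. n \<le> N \<Longrightarrow> N < n + j \<Longrightarrow> w n = H n w" by blast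
    define w' where "w' = w(N - j := H (N - j) w)"
    have "w' n = H n w'" if n: "n \<le> N" "N < n + Suc j" for n
    proof (cases "n = N - j")
      case True
      have "H n w = H n w'" unfolding w'_def using True by (intro H) auto
      then show ?thesis using True by (simp add: w'_def)
    next
      case False
      have "H n w = H n w'" unfolding w'_def using n by (intro H) auto
      then show ?thesis using False n w[of n] by (simp add: w'_def)
    qed
    then show ?case by blast
  qed auto
  from this[of "Suc N"] show ?thesis by auto
qed

text \<open>For each fixed \<open>g\<close> the substitution of \<open>act (- g) x\<close> for
  \<open>x\<close> preserves \<open>M\<close>. The identity converts weights placed on base points
  into multiplicities with which points are covered.\<close>

lemma (in lca_action) nn_integral_action_swap:
  fixes u v :: "'x \<Rightarrow> ennreal"
  assumes [measurable]: "u \<in> borel_measurable M" "v \<in> borel_measurable M" "A \<in> sets m"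
  shows "(\<integral>\<^sup>+x. u x * (\<integral>\<^sup>+g. indicator A g * v (act g x) \<partial>m) \<partial>M) =
         (\<integral>\<^sup>+x. (\<integral>\<^sup>+g. indicator A g * u (act (- g) x) \<partial>m) * v x \<partial>M)"
proof -
  have "(\<integral>\<^sup>+x. u x * (\<integral>\<^sup>+g. indicator A g * v (act g x) \<partial>m) \<partial>M) =
    (\<integral>\<^sup>+x. (\<integral>\<^sup>+g. u x * (indicator A g * v (act g x)) \<partial>m) \<partial>M)"
    by (intro nn_integral_cong nn_integral_cmult[symmetric]) measurable
  also have "\<dots> = (\<integral>\<^sup>+g. (\<integral>\<^sup>+x. u x * (indicator A g * v (act g x)) \<partial>M) \<partial>m)"
    by (rule P.Fubini') measurable
  also have "\<dots> = (\<integral>\<^sup>+g. (\<integral>\<^sup>+x. u (act (- g) x) * (indicator A g * v x) \<partial>M) \<partial>m)"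
  proof (rule nn_integral_cong)
    fix g
    show "(\<integral>\<^sup>+x. u x * (indicator A g * v (act g x)) \<partial>M) =
        (\<integral>\<^sup>+x. u (act (- g) x) * (indicator A g * v x) \<partial>M)"
      using nn_integral_act[of "\<lambda>x. u (act (- g) x) * (indicator A g * v x)" g] by simp
  qed
  also have "\<dots> = (\<integral>\<^sup>+x. (\<integral>\<^sup>+g. u (act (- g) x) * (indicator A g * v x) \<partial>m) \<partial>M)"
    by (rule P.Fubini'[symmetric]) measurable
  also have "\<dots> = (\<integral>\<^sup>+x. (\<integral>\<^sup>+g. (indicator A g * u (act (- g) x)) * v x \<partial>m) \<partial>M)"
    by (simp add: mult_ac)
  also have "\<dots> = (\<integral>\<^sup>+x. (\<integral>\<^sup>+g. indicator A g * u (act (- g) x) \<partial>m) * v x \<partial>M)"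
    by (intro nn_integral_cong nn_integral_multc) measurable
  finally show ?thesis .
qed

locale folner_action = lca_action M m act
  for M :: "'x::topological_space measure"
    and m :: "'g::{topological_ab_group_add, t2_space, second_countable_topology} measure"
    and act :: "'g \<Rightarrow> 'x \<Rightarrow> 'x" +
  fixes F :: "nat \<Rightarrow> 'g set"
  assumes ergodic: "ergodic_measure act M"
    and folner: "strong_folner_sequence m F"
    and temp: "tempered m F"
begin

lemma F_compact: "compact (F n)" and F_pos: "measure m (F n) > 0"
  using folner by (auto simp: strong_folner_sequence_def)

lemma F_sets [measurable]: "F n \<in> sets m"
  by (simp add: F_compact compact_measurable)

lemma emeasure_F: "emeasure m (F n) = ennreal (measure m (F n))"
  using emeasure_compact[OF F_compact[of n]] by (intro emeasure_eq_ennreal_measure) auto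

text \<open>\<open>g\<close> belongs to \<open>dif k n\<close> exactly when \<open>g + F k\<close>
  meets \<open>F n\<close>, that is, when the translates of \<open>F k\<close> at
  \<open>act g x\<close> and of \<open>F n\<close> at \<open>x\<close> can overlap.\<close>

definition dif :: "nat \<Rightarrow> nat \<Rightarrow> 'g set" where
  "dif k n = {- a + b |a b. a \<in> F k \<and> b \<in> F n}"

lemma compact_dif: "compact (dif k n)"
proof -
  have "dif k n = (\<lambda>(a, b). - a + b) ` (F k \<times> F n)" by (auto simp: dif_def)
  moreover have "compact ((\<lambda>(a, b). - a + b) ` (F k \<times> F n))"
    unfolding case_prod_unfold
    by (intro compact_continuous_image compact_Times F_compact continuous_intros)
  ultimately show ?thesis by simp
qed

lemma dif_sets [measurable]: "dif k n \<in> sets m"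
  using compact_dif by (rule compact_measurable)

lemma tempered_emeasure:
  obtains C where "C > 0" "\<And>n. emeasure m (\<Union>k<n. dif k n) \<le> ennreal C * emeasure m (F n)"
proof -
  obtain C where C: "C > 0" "\<And>n. measure m (\<Union>k<n. dif k n) \<le> C * measure m (F n)"
    using temp unfolding tempered_def dif_def by blast
  have "emeasure m (\<Union>k<n. dif k n) \<le> ennreal C * emeasure m (F n)" for n
  proof -
    have "compact (\<Union>k<n. dif k n)" by (intro compact_UN compact_dif) auto
    then have "emeasure m (\<Union>k<n. dif k n) = ennreal (measure m (\<Union>k<n. dif k n))"
      using emeasure_compact by (intro emeasure_eq_ennreal_measure) (auto simp: less_top)
    also have "\<dots> \<le> ennreal (C * measure m (F n))" using C(2) by (rule ennreal_leI)
    finally show ?thesis using C(1) by (simp add: emeasure_F ennreal_mult)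
  qed
  with C(1) show ?thesis by (rule that)
qed

text \<open>
  The weight \<open>w n x\<close> says how strongly the translate \<open>F\<^sub>n x\<close> is selected.  Levels are
  treated from \<open>N\<close> downwards, and \<open>w n\<close> is switched off where the expected number \<open>T n x\<close>
  of already selected translates meeting \<open>F\<^sub>n x\<close> is at least \<open>1\<close>.  Hence no point is covered with
  multiplicity above \<open>2\<close>, and temperedness bounds the part of \<open>E\<close> that is switched off by the total
  mass selected.
\<close>

lemma fractional_covering:
  fixes \<phi> :: "'x \<Rightarrow> ennreal" and E :: "nat \<Rightarrow> 'x set" and \<theta> :: ennreal
  assumes [measurable]: "\<phi> \<in> borel_measurable M" "\<And>n. E n \<in> sets M"
    and disj: "disjoint_family E"
    and C: "\<And>n. emeasure m (\<Union>k<n. dif k n) \<le> C * emeasure m (F n)"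
    and E: "\<And>n x. x \<in> E n \<Longrightarrow> \<theta> * emeasure m (F n) \<le> (\<integral>\<^sup>+g. indicator (F n) g * \<phi> (act g x) \<partial>m)"
  shows "\<theta> * (\<Sum>n\<le>N. emeasure M (E n)) \<le> 2 * (1 + C) * (\<integral>\<^sup>+x. \<phi> x \<partial>M)"
proof -
  define c where "c n = emeasure m (F n)" for n
  have c: "c n > 0" "c n < \<infinity>" for n using F_pos[of n] by (auto simp: c_def emeasure_F)
  have c1: "c n * (1 / c n) = 1" for n
    using c[of n] by (simp add: ennreal_times_divide ennreal_divide_self less_top)
  \<comment> \<open>The value \<open>1 / c n\<close> normalises a level: the base points whose level
    \<open>n\<close> translate covers \<open>y\<close> are the \<open>act (- g) y\<close> with
    \<open>g\<close> in \<open>F n\<close>, a set of measure \<open>c n\<close>, so one level covers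
    \<open>y\<close> at most once.\<close>
  have "\<exists>w. \<forall>n\<le>N. w n = (\<lambda>x. if x \<in> E n \<and>
      (\<Sum>k\<in>{k\<in>{..N}. n < k}. \<integral>\<^sup>+g. indicator (dif n k) g * w k (act (- g) x) \<partial>m) < 1
      then 1 / c n else 0)"
    by (intro downward_recursion ext if_cong refl arg_cong2[where f = "(\<and>)"]
        arg_cong2[where f = "(<)"] sum.cong) auto
  then obtain w :: "nat \<Rightarrow> 'x \<Rightarrow> ennreal" where w0: "\<forall>n\<le>N. w n = (\<lambda>x. if x \<in> E n \<and>
      (\<Sum>k\<in>{k\<in>{..N}. n < k}. \<integral>\<^sup>+g. indicator (dif n k) g * w k (act (- g) x) \<partial>m) < 1
      then 1 / c n else 0)" by blast
  define T where "T n x =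
    (\<Sum>k\<in>{k\<in>{..N}. n < k}. \<integral>\<^sup>+g. indicator (dif n k) g * w k (act (- g) x) \<partial>m)" for n x
  have w: "w n x = (if x \<in> E n \<and> T n x < 1 then 1 / c n else 0)" if "n \<le> N" for n x
    unfolding T_def using w0[rule_format, OF that] by (rule fun_cong)
  have w_meas: "n \<le> N \<Longrightarrow> w n \<in> borel_measurable M" for n
  proof (induction "N - n" arbitrary: n rule: less_induct)
    case less
    have IH [measurable]: "w k \<in> borel_measurable M" if "k \<in> {k\<in>{..N}. n < k}" for k
      using less(1)[of k] that less(2) by auto
    have [measurable]: "T n \<in> borel_measurable M" unfolding T_def by measurable
    show ?case using less(2) by (subst measurable_cong[OF w]) measurable
  qed
  have T_meas: "T n \<in> borel_measurable M" for n
  proof -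
    have [measurable]: "w k \<in> borel_measurable M" if "k \<in> {k\<in>{..N}. n < k}" for k
      using w_meas that by auto
    show ?thesis unfolding T_def by measurable
  qed
  define S where "S n y = (\<integral>\<^sup>+g. indicator (F n) g * w n (act (- g) y) \<partial>m)" for n y
  have S_meas: "S n \<in> borel_measurable M" if "n \<le> N" for n
  proof -
    note [measurable] = w_meas[OF that]
    show ?thesis unfolding S_def by measurable
  qed
  \<comment> \<open>Take the lowest level \<open>k\<close> covering \<open>y\<close> and a base
    point \<open>act (- h) y\<close> of positive weight there. Every higher translate through
    \<open>y\<close> meets the one at this base point, so all higher levels together contribute at
    most \<open>T k\<close> there, which is below 1; level \<open>k\<close> contributes at most
    1.\<close>
  have S2: "(\<Sum>n\<le>N. S n y) \<le> 2" for y
  proof (cases "\<exists>k\<le>N. S k y \<noteq> 0")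
    case True
    define k where "k = (LEAST k. k \<le> N \<and> S k y \<noteq> 0)"
    have k: "k \<le> N" "S k y \<noteq> 0" using LeastI_ex[OF True] by (auto simp: k_def)
    have less: "S j y = 0" if "j < k" for j
      using not_less_Least[of j "\<lambda>k. k \<le> N \<and> S k y \<noteq> 0"] that k(1) by (auto simp: k_def)
    have "\<exists>g. indicator (F k) g * w k (act (- g) y) \<noteq> 0"
    proof (rule ccontr)
      assume "\<nexists>g. indicator (F k) g * w k (act (- g) y) \<noteq> 0"
      then have "indicator (F k) g * w k (act (- g) y) = 0" for g by blast
      then have "S k y = (\<integral>\<^sup>+g. 0 \<partial>m)" unfolding S_def by (intro nn_integral_cong)
      with k show False by simp
    qed
    then obtain h where h: "h \<in> F k" "w k (act (- h) y) \<noteq> 0"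
      by (auto simp: indicator_def split: if_splits)
    have T1: "T k (act (- h) y) < 1" using h(2) w[OF k(1)] by (auto split: if_splits)
    have Sn: "S n y \<le> (\<integral>\<^sup>+g. indicator (dif k n) g * w n (act (- g) (act (- h) y)) \<partial>m)"
      if "n \<le> N" for n
    proof -
      note [measurable] = w_meas[OF that]
      have "S n y = (\<integral>\<^sup>+g. indicator (F n) (h + g) * w n (act (- (h + g)) y) \<partial>m)"
        unfolding S_def by (rule nn_integral_plus[symmetric]) measurable
      also have "\<dots> \<le> (\<integral>\<^sup>+g. indicator (dif k n) g * w n (act (- g) (act (- h) y)) \<partial>m)"
      proof (intro nn_integral_mono mult_mono)
        fix g
        have "h + g \<in> F n \<Longrightarrow> g \<in> dif k n"
          unfolding dif_def using h(1) by (intro CollectI exI[of _ h] exI[of _ "h + g"]) simp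
        then show "indicator (F n) (h + g) \<le> (indicator (dif k n) g :: ennreal)"
          by (auto simp: indicator_def)
        have "- (h + g) = - g + - h" by (simp add: algebra_simps)
        then show "w n (act (- (h + g)) y) \<le> w n (act (- g) (act (- h) y))"
          by (simp only: act_add order_refl)
      qed auto
      finally show ?thesis .
    qed
    have "S k y \<le> (\<integral>\<^sup>+g. indicator (F k) g * (1 / c k) \<partial>m)"
      unfolding S_def by (intro nn_integral_mono mult_left_mono) (auto simp: w[OF k(1)])
    also have "\<dots> = 1" by (subst nn_integral_multc) (auto simp: c1 simp flip: c_def)
    finally have Sk: "S k y \<le> 1" .
    have "{..N} = {..<k} \<union> {k} \<union> {j\<in>{..N}. k < j}" using k(1) by auto
    then have "(\<Sum>n\<le>N. S n y) = (\<Sum>n\<in>{..<k} \<union> {k} \<union> {j\<in>{..N}. k < j}. S n y)"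
      by (rule arg_cong)
    also have "\<dots> = (\<Sum>n<k. S n y) + S k y + (\<Sum>n\<in>{j\<in>{..N}. k < j}. S n y)"
      by (subst sum.union_disjoint; (subst sum.union_disjoint)?) auto
    also have "\<dots> \<le> 0 + 1 + T k (act (- h) y)"
      unfolding T_def using less Sk Sn by (intro add_mono sum_mono) auto
    also have "\<dots> \<le> 0 + 1 + 1" using T1 by (intro add_mono) auto
    finally show ?thesis by simp
  qed auto
  have swap: "(\<integral>\<^sup>+x. w n x * (\<integral>\<^sup>+g. indicator (F n) g * \<phi> (act g x) \<partial>m) \<partial>M) =
      (\<integral>\<^sup>+x. S n x * \<phi> x \<partial>M)" if "n \<le> N" for n
    unfolding S_def using w_meas[OF that] by (intro nn_integral_action_swap) auto
  \<comment> \<open>Where \<open>w n\<close> is positive, the integral of \<open>\<phi>\<close> over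
    the translate is at least \<open>\<theta> * c n\<close>. Moved over to \<open>\<phi>\<close>,
    the weights become the multiplicity, whose bound gives the factor 2.\<close>
  have "\<theta> * (\<Sum>n\<le>N. c n * (\<integral>\<^sup>+x. w n x \<partial>M)) =
      (\<Sum>n\<le>N. \<integral>\<^sup>+x. w n x * (\<theta> * c n) \<partial>M)"
    unfolding sum_distrib_left
    by (intro sum.cong refl) (subst nn_integral_multc, auto simp: w_meas mult_ac)
  also have "\<dots> \<le> (\<Sum>n\<le>N. \<integral>\<^sup>+x. w n x * (\<integral>\<^sup>+g. indicator (F n) g * \<phi> (act g x) \<partial>m) \<partial>M)"
  proof (intro sum_mono nn_integral_mono)
    fix n x assume "n \<in> {..N}"
    then show "w n x * (\<theta> * c n) \<le> w n x * (\<integral>\<^sup>+g. indicator (F n) g * \<phi> (act g x) \<partial>m)"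
      using E[of x n] by (auto simp: w c_def intro!: mult_left_mono)
  qed
  also have "\<dots> = (\<Sum>n\<le>N. \<integral>\<^sup>+x. S n x * \<phi> x \<partial>M)"
    by (intro sum.cong refl swap) auto
  also have "\<dots> = (\<integral>\<^sup>+x. (\<Sum>n\<le>N. S n x) * \<phi> x \<partial>M)"
    unfolding sum_distrib_right using S_meas by (intro nn_integral_sum[symmetric]) auto
  also have "\<dots> \<le> (\<integral>\<^sup>+x. 2 * \<phi> x \<partial>M)"
    by (intro nn_integral_mono mult_right_mono S2) auto
  also have "\<dots> = 2 * (\<integral>\<^sup>+x. \<phi> x \<partial>M)" by (rule nn_integral_cmult) simp
  finally have mass: "\<theta> * (\<Sum>n\<le>N. c n * (\<integral>\<^sup>+x. w n x \<partial>M)) \<le> 2 * (\<integral>\<^sup>+x. \<phi> x \<partial>M)" .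

  define e where "e k = (indicator (E k) :: 'x \<Rightarrow> ennreal)" for k
  have [measurable]: "e k \<in> borel_measurable M" for k by (simp add: e_def)
  define a where "a k n = (\<integral>\<^sup>+x. w n x * (\<integral>\<^sup>+g. indicator (dif k n) g * e k (act g x) \<partial>m) \<partial>M)"
    for k n
  \<comment> \<open>At a point of \<open>E k\<close> either the weight is on and
    \<open>c k * w k\<close> equals 1, or it was switched off because \<open>T k\<close> is at least
    1.\<close>
  have split: "emeasure M (E k) \<le> c k * (\<integral>\<^sup>+x. w k x \<partial>M) + (\<Sum>n\<in>{n\<in>{..N}. k < n}. a k n)"
    if k: "k \<le> N" for k
  proof -
    note [measurable] = w_meas[OF k] T_meas[of k]
    have "emeasure M (E k) = (\<integral>\<^sup>+x. indicator (E k) x \<partial>M)" by simp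
    also have "\<dots> \<le> (\<integral>\<^sup>+x. c k * w k x + T k x * e k x \<partial>M)"
      by (intro nn_integral_mono) (auto simp: w[OF k] c1 not_less e_def indicator_def)
    also have "\<dots> = c k * (\<integral>\<^sup>+x. w k x \<partial>M) + (\<integral>\<^sup>+x. T k x * e k x \<partial>M)"
      by (subst nn_integral_add) (auto simp: nn_integral_cmult)
    also have "(\<integral>\<^sup>+x. T k x * e k x \<partial>M) = (\<Sum>n\<in>{n\<in>{..N}. k < n}.
        \<integral>\<^sup>+x. (\<integral>\<^sup>+g. indicator (dif k n) g * w n (act (- g) x) \<partial>m) * e k x \<partial>M)"
    proof -
      have [measurable]: "w j \<in> borel_measurable M" if "j \<in> {j\<in>{..N}. k < j}" for j
        using w_meas that by auto
      show ?thesis unfolding T_def sum_distrib_right by (rule nn_integral_sum) measurable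
    qed
    also have "\<dots> = (\<Sum>n\<in>{n\<in>{..N}. k < n}. a k n)"
      unfolding a_def using w_meas
      by (intro sum.cong refl nn_integral_action_swap[symmetric] dif_sets) auto
    finally show ?thesis .
  qed
  \<comment> \<open>Temperedness applies when the selected level \<open>n\<close> is fixed and the
    lower levels \<open>k\<close> are summed. Disjointness of the \<open>E k\<close> charges each
    \<open>g\<close> to at most one \<open>k\<close>, so the measure of the union of the
    \<open>dif k n\<close> bounds the sum.\<close>
  have killed: "(\<Sum>k\<in>{k\<in>{..N}. k < n}. a k n) \<le> C * (c n * (\<integral>\<^sup>+x. w n x \<partial>M))" if n: "n \<le> N" for n
  proof -
    note [measurable] = w_meas[OF n]
    have "(\<Sum>k\<in>{k\<in>{..N}. k < n}. a k n) = (\<Sum>k<n. a k n)"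
      using n by (intro sum.cong) auto
    also have "\<dots> = (\<integral>\<^sup>+x. w n x * (\<integral>\<^sup>+g. (\<Sum>k<n. indicator (dif k n) g * e k (act g x)) \<partial>m) \<partial>M)"
      unfolding a_def
      by (subst nn_integral_sum[symmetric], measurable)
         (intro nn_integral_cong, subst nn_integral_sum, auto simp: sum_distrib_left)
    also have "\<dots> \<le> (\<integral>\<^sup>+x. w n x * (\<integral>\<^sup>+g. indicator (\<Union>k<n. dif k n) g \<partial>m) \<partial>M)"
    proof (intro nn_integral_mono mult_left_mono)
      fix x g
      show "(\<Sum>k<n. indicator (dif k n) g * e k (act g x)) \<le>
        (indicator (\<Union>k<n. dif k n) g :: ennreal)"
      proof (cases "\<exists>k<n. g \<in> dif k n \<and> act g x \<in> E k")
        case True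
        then obtain k where k: "k < n" "g \<in> dif k n" "act g x \<in> E k" by blast
        have "act g x \<notin> E j" if "j \<noteq> k" for j
          using disj that k(3) by (auto simp: disjoint_family_on_def)
        then have "(\<Sum>j<n. indicator (dif j n) g * e j (act g x)) =
            (\<Sum>j<n. if j = k then 1 else 0 :: ennreal)"
          using k by (intro sum.cong) (auto simp: e_def)
        then show ?thesis using k by (auto simp: e_def indicator_def)
      next
        case False
        then have "(\<Sum>j<n. indicator (dif j n) g * e j (act g x)) = (0::ennreal)"
          by (intro sum.neutral) (auto simp: e_def indicator_def)
        then show ?thesis by simp
      qed
    qed auto
    also have "\<dots> \<le> (\<integral>\<^sup>+x. w n x * (C * c n) \<partial>M)"
      using C[of n] by (intro nn_integral_mono mult_left_mono) (auto simp: c_def)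
    also have "\<dots> = C * (c n * (\<integral>\<^sup>+x. w n x \<partial>M))"
      by (subst nn_integral_multc) (auto simp: mult_ac)
    finally show ?thesis .
  qed
  have "(\<Sum>k\<le>N. emeasure M (E k)) \<le>
      (\<Sum>k\<le>N. c k * (\<integral>\<^sup>+x. w k x \<partial>M) + (\<Sum>n\<in>{n\<in>{..N}. k < n}. a k n))"
    by (intro sum_mono split) auto
  also have "\<dots> = (\<Sum>k\<le>N. c k * (\<integral>\<^sup>+x. w k x \<partial>M)) + (\<Sum>n\<le>N. \<Sum>k\<in>{k\<in>{..N}. k < n}. a k n)"
    unfolding sum.distrib by (subst sum.swap_restrict) auto
  also have "\<dots> \<le> (\<Sum>k\<le>N. c k * (\<integral>\<^sup>+x. w k x \<partial>M)) + (\<Sum>n\<le>N. C * (c n * (\<integral>\<^sup>+x. w n x \<partial>M)))"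
    by (intro add_left_mono sum_mono killed) auto
  also have "\<dots> = (1 + C) * (\<Sum>k\<le>N. c k * (\<integral>\<^sup>+x. w k x \<partial>M))"
    by (simp add: sum_distrib_left distrib_right sum.distrib)
  finally have "\<theta> * (\<Sum>k\<le>N. emeasure M (E k)) \<le> \<theta> * ((1 + C) * (\<Sum>k\<le>N. c k * (\<integral>\<^sup>+x. w k x \<partial>M)))"
    by (rule mult_left_mono) simp
  also have "\<dots> = (1 + C) * (\<theta> * (\<Sum>k\<le>N. c k * (\<integral>\<^sup>+x. w k x \<partial>M)))" by (simp add: mult_ac)
  also have "\<dots> \<le> (1 + C) * (2 * (\<integral>\<^sup>+x. \<phi> x \<partial>M))" by (intro mult_left_mono mass) simp
  also have "\<dots> = 2 * (1 + C) * (\<integral>\<^sup>+x. \<phi> x \<partial>M)" by (simp only: mult_ac)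
  finally show ?thesis .
qed

text \<open>The covering bound needs disjoint sets, so the exceptional set is split by the first
  index at which the average reaches \<open>\<theta>\<close>; this is what \<open>disjointed\<close>
  does. The bound does not depend on the number of levels and so passes to the full series.\<close>

theorem maximal_inequality:
  obtains C :: real where "C > 0"
    "\<And>\<phi> \<theta>. \<phi> \<in> borel_measurable M \<Longrightarrow>
      \<theta> * emeasure M {x. \<exists>n. \<theta> * emeasure m (F n) \<le> (\<integral>\<^sup>+g. indicator (F n) g * \<phi> (act g x) \<partial>m)}
        \<le> ennreal C * (\<integral>\<^sup>+x. \<phi> x \<partial>M)"
proof -
  obtain C where C: "C > 0" "\<And>n. emeasure m (\<Union>k<n. dif k n) \<le> ennreal C * emeasure m (F n)"
    by (rule tempered_emeasure) blast
  have "\<theta> * emeasure M {x. \<exists>n. \<theta> * emeasure m (F n) \<le> (\<integral>\<^sup>+g. indicator (F n) g * \<phi> (act g x) \<partial>m)}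
        \<le> ennreal (2 * (1 + C)) * (\<integral>\<^sup>+x. \<phi> x \<partial>M)"
    if [measurable]: "\<phi> \<in> borel_measurable M" for \<phi> \<theta>
  proof -
    define L where "L n = {x. \<theta> * emeasure m (F n) \<le> (\<integral>\<^sup>+g. indicator (F n) g * \<phi> (act g x) \<partial>m)}" for n
    have L [measurable]: "L n \<in> sets M" for n
    proof -
      have "{x\<in>space M. \<theta> * emeasure m (F n) \<le> (\<integral>\<^sup>+g. indicator (F n) g * \<phi> (act g x) \<partial>m)} \<in> sets M"
        by measurable
      then show ?thesis by (simp add: L_def)
    qed
    have D: "disjointed L n \<in> sets M" for n
      using sets.range_disjointed_sets[of L M] L by blast
    have bound: "\<theta> * (\<Sum>n\<le>N. emeasure M (disjointed L n)) \<le> 2 * (1 + ennreal C) * (\<integral>\<^sup>+x. \<phi> x \<partial>M)" for N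
      using D disjoint_family_disjointed[of L] C(2) disjointed_subset[of L]
      by (intro fractional_covering) (auto simp: L_def subset_iff)
    have "{x. \<exists>n. \<theta> * emeasure m (F n) \<le> (\<integral>\<^sup>+g. indicator (F n) g * \<phi> (act g x) \<partial>m)} = (\<Union>n. L n)"
      by (auto simp: L_def)
    also have "\<dots> = (\<Union>n. disjointed L n)" by (simp add: UN_disjointed_eq)
    finally have "emeasure M {x. \<exists>n. \<theta> * emeasure m (F n) \<le> (\<integral>\<^sup>+g. indicator (F n) g * \<phi> (act g x) \<partial>m)} =
        (\<Sum>n. emeasure M (disjointed L n))"
      using suminf_emeasure[OF _ disjoint_family_disjointed[of L], of M] D
      by (simp add: image_subset_iff)
    then have "\<theta> * emeasure M {x. \<exists>n. \<theta> * emeasure m (F n) \<le> (\<integral>\<^sup>+g. indicator (F n) g * \<phi> (act g x) \<partial>m)} =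
        (\<Sum>n. \<theta> * emeasure M (disjointed L n))" by simp
    also have "\<dots> \<le> 2 * (1 + ennreal C) * (\<integral>\<^sup>+x. \<phi> x \<partial>M)"
    proof (rule suminf_le_const)
      show "(\<Sum>n<N. \<theta> * emeasure M (disjointed L n)) \<le> 2 * (1 + ennreal C) * (\<integral>\<^sup>+x. \<phi> x \<partial>M)" for N
      proof -
        have "(\<Sum>n<N. \<theta> * emeasure M (disjointed L n)) \<le> (\<Sum>n\<le>N. \<theta> * emeasure M (disjointed L n))"
          by (intro sum_mono2) auto
        then show ?thesis using bound[of N] by (simp add: sum_distrib_left)
      qed
    qed simp
    also have "2 * (1 + ennreal C) = ennreal (2 * (1 + C))"
      using C(1) by (simp add: ennreal_mult)
    finally show ?thesis .
  qed
  then show ?thesis using C(1) by (intro that[of "2 * (1 + C)"]) auto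
qed

end

section \<open>Continuity of translation in mean\<close>

text \<open>
  Without any regularity of \<open>N\<close>: points of the open set \<open>U\<close> stay in \<open>U\<close> under small translations,
  so \<open>U - T\<^sub>g\<^sup>-\<^sup>1 U\<close> becomes small, and \<open>T\<^sub>g\<^sup>-\<^sup>1 U - U\<close> has the same measure by invariance.
\<close>

lemma measure_translate_open:
  fixes T :: "'g::{first_countable_topology, zero} \<Rightarrow> 'y::topological_space \<Rightarrow> 'y"
  assumes sets_N: "sets N = sets borel" and U: "open U" "emeasure N U < \<infinity>"
    and T0: "\<And>x. T 0 x = x" and cont: "\<And>x. continuous_on UNIV (\<lambda>g. T g x)"
    and T_meas: "\<And>g. T g -` U \<in> sets N"
    and inv: "\<And>g. emeasure N (T g -` U) = emeasure N U"
    and u: "u \<longlonglongrightarrow> 0"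
  shows "(\<lambda>n. measure N (sym_diff (T (u n) -` U) U)) \<longlonglongrightarrow> 0"
proof -
  have space_N: "space N = UNIV" using sets_eq_imp_space_eq[OF sets_N] by simp
  have U_sets [measurable]: "U \<in> sets N" using U sets_N by simp
  note T_meas [measurable]
  \<comment> \<open>Dominated convergence is a statement about sequences, hence the sequence
    \<open>u\<close>; first countability of the group later turns it into continuity at 0.\<close>
  have "(\<lambda>n. integral\<^sup>L N (\<lambda>x. indicat_real (U - T (u n) -` U) x)) \<longlonglongrightarrow> integral\<^sup>L N (\<lambda>x. 0)"
  proof (rule integral_dominated_convergence)
    show "integrable N (indicat_real U)" using U by simp
    show "AE x in N. (\<lambda>n. indicat_real (U - T (u n) -` U) x) \<longlonglongrightarrow> 0"
    proof (rule AE_I2)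
      fix x
      show "(\<lambda>n. indicat_real (U - T (u n) -` U) x) \<longlonglongrightarrow> 0"
      proof (cases "x \<in> U")
        case True
        have "(\<lambda>n. T (u n) x) \<longlonglongrightarrow> T 0 x"
          using cont[of x] u by (intro continuous_on_tendsto_compose[of UNIV "\<lambda>g. T g x"]) auto
        then have "eventually (\<lambda>n. T (u n) x \<in> U) sequentially"
          using True U(1) T0 by (auto dest: topological_tendstoD)
        then have "eventually (\<lambda>n. indicat_real (U - T (u n) -` U) x = 0) sequentially"
          by eventually_elim (auto simp: indicator_def)
        then show ?thesis by (rule tendsto_eventually)
      qed (auto simp: indicator_def)
    qed
    show "(\<lambda>x. indicat_real (U - T (u n) -` U) x) \<in> borel_measurable N" for n
      by (intro borel_measurable_indicator sets.Diff U_sets T_meas)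
  qed (auto simp: indicator_def)
  then have lim: "(\<lambda>n. measure N (U - T (u n) -` U)) \<longlonglongrightarrow> 0"
    by (simp add: space_N)
  have "measure N (sym_diff (T g -` U) U) = 2 * measure N (U - T g -` U)" for g
  proof -
    have fin: "emeasure N A \<noteq> \<infinity>" if "A \<subseteq> U \<or> A \<subseteq> T g -` U" for A
      using that U(2) inv[of g] emeasure_mono[of A U N] emeasure_mono[of A "T g -` U" N]
      by (auto simp: top_unique)
    have "measure N (sym_diff (T g -` U) U) = measure N (T g -` U - U) + measure N (U - T g -` U)"
      by (intro measure_Union fin) auto
    moreover have "measure N (T g -` U - U) = measure N (T g -` U) - measure N (T g -` U \<inter> U)"
      using U(2) inv[of g] by (subst measure_Diff[symmetric]) (auto intro!: arg_cong[of _ _ "measure N"])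
    moreover have "measure N (U - T g -` U) = measure N U - measure N (T g -` U \<inter> U)"
      using U(2) inv[of g] by (subst measure_Diff[symmetric]) (auto intro!: arg_cong[of _ _ "measure N"])
    moreover have "measure N (T g -` U) = measure N U" using inv by (simp add: measure_def)
    ultimately show ?thesis by simp
  qed
  then show ?thesis using tendsto_mult[OF tendsto_const[of 2] lim] by simp
qed

section \<open>From open sets to integrable functions\<close>

context lca_action begin

lemma integrable_act:
  fixes f :: "'x \<Rightarrow> 'b::{banach, second_countable_topology}"
  assumes "integrable M f" shows "integrable M (\<lambda>x. f (act g x))"
  using assms by (subst (asm) distr_act[of g, symmetric], subst (asm) integrable_distr_eq) auto

definition displacement :: "('x \<Rightarrow> 'b::{banach, second_countable_topology}) \<Rightarrow> 'g \<Rightarrow> real" where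
  "displacement f g = (\<integral>x. norm (f (act g x) - f x) \<partial>M)"

lemma displacement_nonneg: "displacement f g \<ge> 0"
  by (simp add: displacement_def)

lemma displacement_add:
  assumes "integrable M f" "integrable M f'"
  shows "displacement (\<lambda>x. f x + f' x) g \<le> displacement f g + displacement f' g"
proof -
  note [simp] = assms integrable_act[OF assms(1)] integrable_act[OF assms(2)]
  have "displacement (\<lambda>x. f x + f' x) g \<le>
      (\<integral>x. norm (f (act g x) - f x) + norm (f' (act g x) - f' x) \<partial>M)"
    unfolding displacement_def
  proof (intro integral_mono)
    fix x
    have "f (act g x) + f' (act g x) - (f x + f' x) = (f (act g x) - f x) + (f' (act g x) - f' x)"
      by simp
    then show "norm (f (act g x) + f' (act g x) - (f x + f' x)) \<le>
        norm (f (act g x) - f x) + norm (f' (act g x) - f' x)"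
      by (metis norm_triangle_ineq)
  qed auto
  then show ?thesis by (simp add: displacement_def)
qed

lemma displacement_limit_add:
  assumes "integrable M f" "integrable M f'"
    and "(\<lambda>n. displacement f (u n)) \<longlonglongrightarrow> 0" "(\<lambda>n. displacement f' (u n)) \<longlonglongrightarrow> 0"
  shows "(\<lambda>n. displacement (\<lambda>x. f x + f' x) (u n)) \<longlonglongrightarrow> 0"
proof (rule tendsto_sandwich[OF _ _ tendsto_const])
  show "(\<lambda>n. displacement f (u n) + displacement f' (u n)) \<longlonglongrightarrow> 0"
    using tendsto_add[OF assms(3,4)] by simp
qed (auto simp: displacement_nonneg displacement_add assms)

text \<open>By invariance the error \<open>f - f'\<close> has the same L1 norm before and after
  translation. It enters twice, and the displacement of \<open>f'\<close> once, hence the thirds in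
  the proof.\<close>

lemma displacement_limit_closed:
  assumes f: "integrable M f"
    and approx: "\<And>e. e > 0 \<Longrightarrow> \<exists>f'. integrable M f' \<and>
      (\<lambda>n. displacement f' (u n)) \<longlonglongrightarrow> 0 \<and> (\<integral>x. norm (f x - f' x) \<partial>M) < e"
  shows "(\<lambda>n. displacement f (u n)) \<longlonglongrightarrow> 0"
proof (rule LIMSEQ_I)
  fix r :: real assume "r > 0"
  then obtain f' where f': "integrable M f'" "(\<lambda>n. displacement f' (u n)) \<longlonglongrightarrow> 0"
      "(\<integral>x. norm (f x - f' x) \<partial>M) < r / 3"
    using approx[of "r / 3"] by auto
  have bound: "displacement f g \<le> displacement f' g + 2 * (\<integral>x. norm (f x - f' x) \<partial>M)" for g
  proof -
    note [simp] = f f'(1) integrable_act[OF f] integrable_act[OF f'(1)]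
    have "displacement f g \<le> displacement f' g + displacement (\<lambda>x. f x - f' x) g"
      using displacement_add[of f' "\<lambda>x. f x - f' x" g] by simp
    also have "displacement (\<lambda>x. f x - f' x) g \<le>
        (\<integral>x. norm (f (act g x) - f' (act g x)) + norm (f x - f' x) \<partial>M)"
      unfolding displacement_def by (intro integral_mono norm_triangle_ineq4) auto
    also have "\<dots> = 2 * (\<integral>x. norm (f x - f' x) \<partial>M)"
      using integral_act[of "\<lambda>x. norm (f x - f' x)" g] f f'(1)
      by (simp add: borel_measurable_integrable)
    finally show ?thesis by simp
  qed
  obtain N where N: "\<And>n. n \<ge> N \<Longrightarrow> displacement f' (u n) < r / 3"
    using order_tendstoD(2)[OF f'(2), of "r / 3"] \<open>r > 0\<close> by (auto simp: eventually_sequentially)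
  have "norm (displacement f (u n) - 0) < r" if "n \<ge> N" for n
    using bound[of "u n"] N[OF that] f'(3) displacement_nonneg[of f "u n"] by simp
  then show "\<exists>N. \<forall>n\<ge>N. norm (displacement f (u n) - 0) < r" by blast
qed

text \<open>The sets with this property form a Dynkin system: passing to complements keeps the
  symmetric differences, and a disjoint union is an L1 limit of finite ones. It contains the open
  sets, which are stable under intersection and generate the Borel sets. The vector \<open>c\<close>
  is carried along for the induction over integrable functions.\<close>

lemma displacement_limit_indicator:
  fixes c :: "'b::{banach, second_countable_topology}"
  assumes u: "u \<longlonglongrightarrow> 0" and B: "B \<in> sets M"
  shows "(\<lambda>n. displacement (\<lambda>x. indicat_real B x *\<^sub>R c) (u n)) \<longlonglongrightarrow> 0"
proof -
  have disp: "displacement (\<lambda>x. indicat_real B x *\<^sub>R c) g = norm c * prob (sym_diff (act g -` B) B)"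
    if [measurable]: "B \<in> sets M" for B g
  proof -
    have "norm (indicat_real B (act g x) *\<^sub>R c - indicat_real B x *\<^sub>R c) =
        norm c * indicator (sym_diff (act g -` B) B) x" for x
      by (auto simp: indicator_def)
    then show ?thesis by (simp add: displacement_def)
  qed
  have int: "integrable M (\<lambda>x. indicat_real B x *\<^sub>R c)" if "B \<in> sets M" for B
    using that by (intro integrable_scaleR_left) (simp add: emeasure_eq_measure)
  have cont: "continuous_on UNIV (\<lambda>g. act g x)" for x
    using continuous_on_compose2[OF continuous_act, of UNIV "\<lambda>g. (g, x)"]
    by (simp add: continuous_on_Pair)
  have act_meas: "act g -` B \<in> sets M" if "B \<in> sets M" for B g
    using measurable_sets[of "act g" M M B] that by simp
  have stable: "Int_stable {S::'x set. open S}" by (auto simp: Int_stable_def)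
  have sub: "{S::'x set. open S} \<subseteq> Pow UNIV" by simp
  have "B \<in> sigma_sets UNIV {S. open S}"
    using B by (simp add: sets_M borel_def)
  then show ?thesis
  proof (induct rule: sigma_sets_induct_disjoint[OF stable sub, consumes 1, case_names basic empty compl union])
    case (basic A)
    then have "(\<lambda>n. prob (sym_diff (act (u n) -` A) A)) \<longlonglongrightarrow> 0"
      using u cont act_meas[of A] emeasure_act[of A]
      by (intro measure_translate_open) (auto simp: sets_M emeasure_eq_measure)
    from tendsto_mult[OF tendsto_const[of "norm c"] this] show ?case
      using basic by (simp add: disp sets_M)
  next
    case (compl A)
    then have A: "A \<in> sets M" by (simp add: sets_M borel_def)
    have "sym_diff (act g -` (UNIV - A)) (UNIV - A) = sym_diff (act g -` A) A" for g by auto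
    then show ?case using compl(2) A sets.compl_sets[OF A] by (simp add: disp)
  next
    case (union A)
    then have A: "A i \<in> sets M" for i by (auto simp: sets_M borel_def)
    define D where "D N = (\<Union>i<N. A i)" for N
    have D [simp]: "D N \<in> sets M" for N unfolding D_def using A by auto
    have D_lim: "(\<lambda>n. displacement (\<lambda>x. indicat_real (D N) x *\<^sub>R c) (u n)) \<longlonglongrightarrow> 0" for N
    proof (induction N)
      case 0
      then show ?case by (simp add: D_def displacement_def)
    next
      case (Suc N)
      have "A i \<inter> A N = {}" if "i < N" for i
        using union(1) that by (auto simp: disjoint_family_on_def)
      then have "D N \<inter> A N = {}" by (auto simp: D_def)
      then have "indicat_real (D (Suc N)) x *\<^sub>R c = indicat_real (D N) x *\<^sub>R c + indicat_real (A N) x *\<^sub>R c" for x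
        by (auto simp: D_def indicator_def less_Suc_eq)
      then show ?case using displacement_limit_add[OF int[OF D] int[OF A] Suc union(3)[of N]] by simp
    qed
    have "incseq D" unfolding D_def by (intro monoI UN_mono) auto
    then have "(\<lambda>N. prob (D N)) \<longlonglongrightarrow> prob (\<Union>N. D N)"
      using D by (intro finite_Lim_measure_incseq) blast+
    moreover have "(\<Union>N. D N) = (\<Union>i. A i)" by (auto simp: D_def)
    ultimately have conv: "(\<lambda>N. prob (\<Union>i. A i) - prob (D N)) \<longlonglongrightarrow> 0"
      using tendsto_diff[OF tendsto_const[of "prob (\<Union>i. A i)"]] by fastforce
    show ?case
    proof (rule displacement_limit_closed)
      show "integrable M (\<lambda>x. indicat_real (\<Union>i. A i) x *\<^sub>R c)" using A by (intro int) auto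
      fix e :: real assume "e > 0"
      have "(\<lambda>N. norm c * (prob (\<Union>i. A i) - prob (D N))) \<longlonglongrightarrow> 0"
        using tendsto_mult[OF tendsto_const[of "norm c"] conv] by simp
      then have "eventually (\<lambda>N. norm c * (prob (\<Union>i. A i) - prob (D N)) < e) sequentially"
        using \<open>e > 0\<close> by (rule order_tendstoD)
      then obtain N where N: "norm c * (prob (\<Union>i. A i) - prob (D N)) < e"
        by (meson eventually_sequentially order_refl)
      have "norm (indicat_real (\<Union>i. A i) x *\<^sub>R c - indicat_real (D N) x *\<^sub>R c) =
          norm c * indicat_real ((\<Union>i. A i) - D N) x" for x
        by (auto simp: indicator_def D_def)
      then have "(\<integral>x. norm (indicat_real (\<Union>i. A i) x *\<^sub>R c - indicat_real (D N) x *\<^sub>R c) \<partial>M) =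
          norm c * prob ((\<Union>i. A i) - D N)" by simp
      also have "prob ((\<Union>i. A i) - D N) = prob (\<Union>i. A i) - prob (D N)"
        using A by (intro finite_measure_Diff) (auto simp: D_def)
      finally show "\<exists>f'. integrable M f' \<and> (\<lambda>n. displacement f' (u n)) \<longlonglongrightarrow> 0 \<and>
          (\<integral>x. norm (indicat_real (\<Union>i. A i) x *\<^sub>R c - f' x) \<partial>M) < e"
        using N D_lim int[OF D] by (intro exI[of _ "\<lambda>x. indicat_real (D N) x *\<^sub>R c"]) auto
    qed
  qed (auto simp: Int_stable_def displacement_def)
qed

theorem displacement_tendsto_0:
  assumes u: "u \<longlonglongrightarrow> 0" and f: "integrable M f"
  shows "(\<lambda>n. displacement f (u n)) \<longlonglongrightarrow> 0"
  using f
proof (induct rule: integrable_induct)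
  case (base A c)
  then show ?case using displacement_limit_indicator[OF u] by simp
next
  case (add f g)
  then show ?case by (intro displacement_limit_add)
next
  case (lim f s)
  have "(\<lambda>i. \<integral>x. norm (s i x - f x) \<partial>M) \<longlonglongrightarrow> (\<integral>x. 0 \<partial>M)"
  proof (rule integral_dominated_convergence)
    \<comment> \<open>The approximants obey \<open>norm (s i x) \<le> 2 * norm (f x)\<close>; the
      difference from \<open>f\<close> adds one more \<open>norm (f x)\<close>.\<close>
    show "integrable M (\<lambda>x. 3 * norm (f x))" using lim(5) by simp
    show "AE x in M. (\<lambda>i. norm (s i x - f x)) \<longlonglongrightarrow> 0"
      using lim(3) by (intro AE_I2 tendsto_norm_zero LIM_zero)
    show "AE x in M. norm (norm (s i x - f x)) \<le> 3 * norm (f x)" for i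
    proof (rule AE_I2)
      fix x assume "x \<in> space M"
      then show "norm (norm (s i x - f x)) \<le> 3 * norm (f x)"
        using lim(4)[of x i] norm_triangle_ineq4[of "s i x" "f x"] by simp
    qed
  qed (use lim in auto)
  then have L: "(\<lambda>i. \<integral>x. norm (f x - s i x) \<partial>M) \<longlonglongrightarrow> 0"
    by (simp add: norm_minus_commute)
  show ?case
  proof (rule displacement_limit_closed)
    fix e :: real assume "e > 0"
    then have "eventually (\<lambda>i. (\<integral>x. norm (f x - s i x) \<partial>M) < e) sequentially"
      using order_tendstoD(2)[OF L] by blast
    then obtain i where "(\<integral>x. norm (f x - s i x) \<partial>M) < e"
      by (meson eventually_sequentially order_refl)
    then show "\<exists>f'. integrable M f' \<and> (\<lambda>n. displacement f' (u n)) \<longlonglongrightarrow> 0 \<and> (\<integral>x. norm (f x - f' x) \<partial>M) < e"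
      using lim(1,2) by blast
  qed (rule lim(5))
qed

end

section \<open>The mean ergodic theorem\<close>

context lca_action begin

lemma integrable_bounded:
  fixes f :: "'x \<Rightarrow> 'b::{banach, second_countable_topology}"
  assumes "f \<in> borel_measurable M" "\<And>x. norm (f x) \<le> B" shows "integrable M f"
  using assms by (intro integrable_const_bound[of _ B]) auto

lemma integrable_square_bounded:
  fixes h :: "'x \<Rightarrow> real"
  assumes "h \<in> borel_measurable M" "\<And>x. \<bar>h x\<bar> \<le> B" shows "integrable M (\<lambda>x. (h x)\<^sup>2)"
proof -
  have "(h x)\<^sup>2 \<le> B\<^sup>2" for x using assms(2)[of x] by (metis abs_ge_zero power2_abs power_mono)
  then show ?thesis using assms(1) by (intro integrable_bounded[of _ "B\<^sup>2"]) auto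
qed

text \<open>Instead of Cauchy-Schwarz, the pointwise bound
  \<open>|h| \<le> h\<^sup>2 / (2 * e) + e / 2\<close> is integrated; it is the expanded form of a
  square being nonnegative.\<close>

lemma L1_le_L2:
  fixes h :: "'x \<Rightarrow> real"
  assumes h: "h \<in> borel_measurable M" "\<And>x. \<bar>h x\<bar> \<le> B" and e: "e > 0" "(\<integral>x. (h x)\<^sup>2 \<partial>M) \<le> e\<^sup>2"
  shows "(\<integral>x. \<bar>h x\<bar> \<partial>M) \<le> e"
proof -
  have sq: "integrable M (\<lambda>x. (h x)\<^sup>2)"
    using h by (rule integrable_square_bounded)
  have "(\<integral>x. \<bar>h x\<bar> \<partial>M) \<le> (\<integral>x. (h x)\<^sup>2 / (2 * e) + e / 2 \<partial>M)"
  proof (rule integral_mono)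
    show "integrable M (\<lambda>x. \<bar>h x\<bar>)" by (intro integrable_abs integrable_bounded[of h B]) (use h in auto)
    fix x
    have "0 \<le> (\<bar>h x\<bar> - e)\<^sup>2" by simp
    then show "\<bar>h x\<bar> \<le> (h x)\<^sup>2 / (2 * e) + e / 2"
      using e(1) by (simp add: field_simps power2_eq_square)
  qed (use sq in auto)
  also have "\<dots> = (\<integral>x. (h x)\<^sup>2 \<partial>M) / (2 * e) + e / 2"
    using sq prob_space by simp
  also have "\<dots> \<le> e\<^sup>2 / (2 * e) + e / 2"
    using e by (intro add_right_mono divide_right_mono) auto
  also have "\<dots> = e" using e(1) by (simp add: power2_eq_square)
  finally show ?thesis .
qed

end

text \<open>These are the dyadic convex combinations of translates. The parallelogram law works with
  midpoints, and induction over midpoints replaces explicit finite sums.\<close>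

inductive_set orbit_averages :: "('g \<Rightarrow> 'x \<Rightarrow> 'x) \<Rightarrow> ('x \<Rightarrow> real) \<Rightarrow> ('x \<Rightarrow> real) set"
  for act u where
  base: "(\<lambda>x. u (act g x)) \<in> orbit_averages act u"
| mid: "v \<in> orbit_averages act u \<Longrightarrow> w \<in> orbit_averages act u \<Longrightarrow>
    (\<lambda>x. (v x + w x) / 2) \<in> orbit_averages act u"

context lca_action begin

lemma orbit_averages_measurable:
  assumes "w \<in> orbit_averages act u" and [measurable]: "u \<in> borel_measurable M"
  shows "w \<in> borel_measurable M"
  using assms(1)
proof induct
  case (mid v w)
  note [measurable] = mid(2,4)
  show ?case by measurable
qed measurable

lemma orbit_averages_bound:
  assumes "w \<in> orbit_averages act u" "\<And>x. \<bar>u x\<bar> \<le> B"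
  shows "\<bar>w x\<bar> \<le> B"
  using assms(1)
proof (induct arbitrary: x)
  case (mid v w)
  show ?case using mid(2)[of x] mid(4)[of x] abs_triangle_ineq[of "v x" "w x"] by simp
qed (rule assms(2))

lemma orbit_averages_act:
  assumes "w \<in> orbit_averages act u"
  shows "(\<lambda>x. w (act g x)) \<in> orbit_averages act u"
  using assms
proof induct
  case (base h)
  then show ?case using orbit_averages.base[of u act "h + g"] by (simp add: act_add)
next
  case (mid v w)
  show ?case by (rule orbit_averages.mid[OF mid(2,4)])
qed

lemma orbit_averages_integral:
  assumes "w \<in> orbit_averages act u" and u: "u \<in> borel_measurable M" "\<And>x. \<bar>u x\<bar> \<le> B"
  shows "(\<integral>x. w x \<partial>M) = (\<integral>x. u x \<partial>M)"
  using assms(1)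
proof induct
  case (base g)
  then show ?case using integral_act[OF u(1)] .
next
  case (mid v w)
  have "integrable M v" "integrable M w"
    using orbit_averages_measurable[OF mid(1) u(1)] orbit_averages_bound[OF mid(1) u(2)]
      orbit_averages_measurable[OF mid(3) u(1)] orbit_averages_bound[OF mid(3) u(2)]
    by (auto intro!: integrable_bounded)
  then show ?case using mid by simp
qed

text \<open>Ergodicity is applied to the single set where \<open>v\<close> is positive: whether it
  is null or full, \<open>v\<close> has constant sign almost everywhere, and a vanishing integral
  then forces \<open>v\<close> to vanish.\<close>

lemma invariant_function_eq_0:
  fixes v :: "'x \<Rightarrow> real"
  assumes erg: "ergodic_measure act M"
    and v: "integrable M v" "(\<integral>x. v x \<partial>M) = 0"
    and inv: "\<And>g. AE x in M. v (act g x) = v x"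
  shows "AE x in M. v x = 0"
proof -
  have [measurable]: "v \<in> borel_measurable M" using v(1) by simp
  define B where "B = {x. v x > 0}"
  have B [measurable]: "B \<in> sets M"
    using measurable_sets[of v M borel "{0<..}"] by (simp add: B_def vimage_def)
  have "emeasure M (sym_diff (act g ` B) B) = 0" for g
  proof -
    have "act g ` B = act (- g) -` B"
    proof (intro set_eqI iffI)
      fix x assume "x \<in> act (- g) -` B"
      then show "x \<in> act g ` B" by (intro image_eqI[of _ _ "act (- g) x"]) auto
    qed auto
    then have "sym_diff (act g ` B) B \<subseteq> {x\<in>space M. \<not> v (act (- g) x) = v x}"
      by (auto simp: B_def)
    from emeasure_mono[OF this, of M] have "emeasure M (sym_diff (act g ` B) B) \<le> 0"
      using AE_E2[OF inv[of "- g"]] by simp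
    then show ?thesis by simp
  qed
  then have "emeasure M B = 0 \<or> emeasure M B = 1"
    using erg B unfolding ergodic_measure_def by blast
  then show ?thesis
  proof
    assume "emeasure M B = 0"
    then have "AE x in M. x \<notin> B" by (intro AE_not_in) (simp add: null_setsI)
    then have nn: "AE x in M. 0 \<le> - v x" by (auto simp: B_def not_less)
    have "(\<integral>x. - v x \<partial>M) = 0" using v by simp
    then show ?thesis using integral_nonneg_eq_0_iff_AE[OF _ nn] v(1) by simp
  next
    assume "emeasure M B = 1"
    then have "AE x in M. x \<in> B" using prob_eq_1[OF B] by (simp add: measure_def)
    then have nn: "AE x in M. 0 \<le> v x" by (auto simp: B_def)
    then show ?thesis using integral_nonneg_eq_0_iff_AE[OF v(1) nn] v by simp
  qed
qed

text \<open>
  The averages of nearly minimal \<open>L\<^sub>2\<close>-norm form a Cauchy sequence by the parallelogram law, and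
  so do their translates; the limit is therefore an invariant function, hence zero.
\<close>

theorem mean_ergodic:
  fixes u :: "'x \<Rightarrow> real"
  assumes erg: "ergodic_measure act M"
    and u [measurable]: "u \<in> borel_measurable M" and B: "\<And>x. \<bar>u x\<bar> \<le> B"
    and u0: "(\<integral>x. u x \<partial>M) = 0" and e: "e > 0"
  shows "\<exists>w\<in>orbit_averages act u. (\<integral>x. \<bar>w x\<bar> \<partial>M) < e"
proof -
  let ?H = "orbit_averages act u"
  have H_meas [measurable]: "w \<in> borel_measurable M" if "w \<in> ?H" for w
    using orbit_averages_measurable[OF that u] .
  have H_bound: "\<bar>w x\<bar> \<le> B" if "w \<in> ?H" for w x using orbit_averages_bound[OF that B] .
  have H_sq: "integrable M (\<lambda>x. (w x)\<^sup>2)" if "w \<in> ?H" for w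
    by (rule integrable_square_bounded[OF H_meas[OF that] H_bound[OF that]])
  define q where "q w = (\<integral>x. (w x)\<^sup>2 \<partial>M)" for w :: "'x \<Rightarrow> real"
  define \<delta> where "\<delta> = Inf (q ` ?H)"
  have q0: "q w \<ge> 0" for w by (simp add: q_def)
  have bdd: "bdd_below (q ` ?H)" using q0 by (intro bdd_belowI[of _ 0]) auto
  have ne: "q ` ?H \<noteq> {}" using orbit_averages.base[of u act 0] by blast
  have \<delta>_le: "\<delta> \<le> q w" if "w \<in> ?H" for w unfolding \<delta>_def using that bdd by (intro cInf_lower) auto
  \<comment> \<open>The midpoint is again an orbit average, so its squared norm is at least
    \<open>\<delta>\<close>; the parallelogram law leaves only the excesses \<open>s\<close> and
    \<open>t\<close>.\<close>
  have par: "(\<integral>x. (v x - w x)\<^sup>2 \<partial>M) \<le> 2 * (s + t)"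
    if vw: "v \<in> ?H" "w \<in> ?H" "q v \<le> \<delta> + s" "q w \<le> \<delta> + t" for v w s t
  proof -
    have "(\<integral>x. (v x - w x)\<^sup>2 \<partial>M) = (\<integral>x. 2 * (v x)\<^sup>2 + 2 * (w x)\<^sup>2 - 4 * ((v x + w x) / 2)\<^sup>2 \<partial>M)"
      by (intro Bochner_Integration.integral_cong refl) (simp add: power2_eq_square field_simps)
    also have "\<dots> = 2 * q v + 2 * q w - 4 * q (\<lambda>x. (v x + w x) / 2)"
      using H_sq[OF vw(1)] H_sq[OF vw(2)] H_sq[OF orbit_averages.mid[OF vw(1,2)]]
      unfolding q_def by simp
    also have "\<dots> \<le> 2 * (s + t)"
      using vw(3,4) \<delta>_le[OF orbit_averages.mid[OF vw(1,2)]] by simp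
    finally show ?thesis .
  qed
  have "\<exists>w\<in>?H. q w < \<delta> + 1 / real (Suc n)" for n
    using cInf_lessD[OF ne, of "\<delta> + 1 / real (Suc n)"] unfolding \<delta>_def by auto
  then obtain W where W: "\<And>n. W n \<in> ?H" "\<And>n. q (W n) < \<delta> + 1 / real (Suc n)" by metis
  \<comment> \<open>An excess of \<open>d\<^sup>2 / 4\<close> on both sides makes the bound in
    \<open>par\<close> exactly \<open>d\<^sup>2\<close>.\<close>
  have L1: "(\<integral>x. \<bar>v x - w x\<bar> \<partial>M) \<le> d"
    if vw: "v \<in> ?H" "w \<in> ?H" "q v \<le> \<delta> + d\<^sup>2 / 4" "q w \<le> \<delta> + d\<^sup>2 / 4" "d > 0" for v w d
  proof (rule L1_le_L2[of _ "2 * B"])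
    show "(\<lambda>x. v x - w x) \<in> borel_measurable M" using vw(1,2) by measurable
    show "\<bar>v x - w x\<bar> \<le> 2 * B" for x using H_bound[OF vw(1), of x] H_bound[OF vw(2), of x] by linarith
    show "(\<integral>x. (v x - w x)\<^sup>2 \<partial>M) \<le> d\<^sup>2" using par[OF vw(1-4)] by simp
  qed (rule vw(5))
  have small: "\<exists>N. \<forall>n\<ge>N. q (W n) \<le> \<delta> + d\<^sup>2 / 4" if "d > 0" for d
  proof -
    have "d\<^sup>2 / 4 > 0" using that by simp
    then obtain N where N: "1 / real (Suc N) < d\<^sup>2 / 4" using nat_approx_posE by blast
    have "q (W n) \<le> \<delta> + d\<^sup>2 / 4" if "n \<ge> N" for n
    proof -
      have "1 / real (Suc n) \<le> 1 / real (Suc N)" using that by (intro divide_left_mono) auto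
      then show ?thesis using W(2)[of n] N by linarith
    qed
    then show ?thesis by blast
  qed
  have W_int: "integrable M (W n)" for n
    using H_meas[OF W(1)] H_bound[OF W(1)] by (intro integrable_bounded) auto
  obtain r where r: "strict_mono r" "AE x in M. Cauchy (\<lambda>i. W (r i) x)"
  proof (rule cauchy_L1_AE_cauchy_subseq[OF W_int])
    fix d :: real assume "d > 0"
    then obtain N where N: "\<And>n. n \<ge> N \<Longrightarrow> q (W n) \<le> \<delta> + (d / 2)\<^sup>2 / 4" using small[of "d / 2"] by auto
    have "(\<integral>x. norm (W i x - W j x) \<partial>M) < d" if "i \<ge> N" "j \<ge> N" for i j
      using L1[OF W(1) W(1) N[OF that(1)] N[OF that(2)]] \<open>d > 0\<close> by simp
    then show "\<exists>N. \<forall>i\<ge>N. \<forall>j\<ge>N. (\<integral>x. norm (W i x - W j x) \<partial>M) < d" by blast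
  qed
  \<comment> \<open>Where the subsequence diverges, \<open>lim\<close> has an unspecified value; by
    the choice of \<open>r\<close> this concerns only a null set.\<close>
  define v where "v x = lim (\<lambda>i. W (r i) x)" for x
  have v_meas [measurable]: "v \<in> borel_measurable M"
    unfolding v_def by (intro borel_measurable_lim_metric H_meas W(1))
  have conv: "AE x in M. (\<lambda>i. W (r i) x) \<longlonglongrightarrow> v x"
    using r(2) by eventually_elim (auto simp: v_def Cauchy_convergent_iff convergent_LIMSEQ_iff)
  note [measurable] = H_meas[OF W(1)]
  have v_int: "integrable M v"
    and int_conv: "(\<lambda>i. \<integral>x. W (r i) x \<partial>M) \<longlonglongrightarrow> (\<integral>x. v x \<partial>M)"
    using conv H_bound[OF W(1)]
    by (intro integrable_dominated_convergence[of v M "\<lambda>i. W (r i)" "\<lambda>_. B"]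
        integral_dominated_convergence[of v M "\<lambda>i. W (r i)" "\<lambda>_. B"]; simp)+
  have "(\<integral>x. v x \<partial>M) = 0"
    using int_conv u0 orbit_averages_integral[OF W(1) u B] by (simp add: LIMSEQ_const_iff)
  moreover have "AE x in M. v (act g x) = v x" for g
  proof -
    have "(\<lambda>i. \<integral>x. \<bar>W (r i) (act g x) - W (r i) x\<bar> \<partial>M) \<longlonglongrightarrow> (\<integral>x. \<bar>v (act g x) - v x\<bar> \<partial>M)"
    proof (rule integral_dominated_convergence[where w = "\<lambda>_. 2 * B"])
      show "AE x in M. (\<lambda>i. \<bar>W (r i) (act g x) - W (r i) x\<bar>) \<longlonglongrightarrow> \<bar>v (act g x) - v x\<bar>"
        using conv AE_act[OF conv, of g] by eventually_elim (intro tendsto_intros)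
      show "AE x in M. norm \<bar>W (r i) (act g x) - W (r i) x\<bar> \<le> 2 * B" for i
      proof (rule AE_I2)
        fix x
        show "norm \<bar>W (r i) (act g x) - W (r i) x\<bar> \<le> 2 * B"
          using H_bound[OF W(1), of "r i" x] H_bound[OF W(1), of "r i" "act g x"] by simp
      qed
    qed auto
    \<comment> \<open>A translate of \<open>W n\<close> is an orbit average with the same squared
      norm, so it is as nearly minimal as \<open>W n\<close> and must lie close to it.\<close>
    moreover have "(\<lambda>i. \<integral>x. \<bar>W (r i) (act g x) - W (r i) x\<bar> \<partial>M) \<longlonglongrightarrow> 0"
    proof (rule LIMSEQ_I)
      fix d :: real assume "d > 0"
      then obtain N where N: "\<And>n. n \<ge> N \<Longrightarrow> q (W n) \<le> \<delta> + (d / 2)\<^sup>2 / 4" using small[of "d / 2"] by auto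
      have q_act: "q (\<lambda>x. W n (act g x)) = q (W n)" for n
        unfolding q_def using integral_act[of "\<lambda>x. (W n x)\<^sup>2" g] by simp
      have "norm ((\<integral>x. \<bar>W (r i) (act g x) - W (r i) x\<bar> \<partial>M) - 0) < d" if "i \<ge> N" for i
      proof -
        have "q (W (r i)) \<le> \<delta> + (d / 2)\<^sup>2 / 4"
          using seq_suble[OF r(1), of i] that by (intro N) simp
        then have "(\<integral>x. \<bar>W (r i) (act g x) - W (r i) x\<bar> \<partial>M) \<le> d / 2"
          using \<open>d > 0\<close> by (intro L1 orbit_averages_act W(1)) (simp_all add: q_act)
        then show ?thesis using \<open>d > 0\<close> by (simp add: integral_nonneg_AE)
      qed
      then show "\<exists>N. \<forall>i\<ge>N. norm ((\<integral>x. \<bar>W (r i) (act g x) - W (r i) x\<bar> \<partial>M) - 0) < d" by blast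
    qed
    ultimately have "(\<integral>x. \<bar>v (act g x) - v x\<bar> \<partial>M) = 0" by (rule LIMSEQ_unique)
    moreover have "integrable M (\<lambda>x. \<bar>v (act g x) - v x\<bar>)"
      using v_int integrable_distr[of "act g" M M v] by (simp add: distr_act)
    ultimately have "AE x in M. \<bar>v (act g x) - v x\<bar> = 0"
      by (subst integral_nonneg_eq_0_iff_AE[symmetric]) auto
    then show ?thesis by auto
  qed
  ultimately have v0: "AE x in M. v x = 0" by (intro invariant_function_eq_0[OF erg v_int])
  have "(\<lambda>i. \<integral>x. \<bar>W (r i) x\<bar> \<partial>M) \<longlonglongrightarrow> (\<integral>x. 0 \<partial>M)"
  proof (rule integral_dominated_convergence[where w = "\<lambda>_. B"])
    show "AE x in M. (\<lambda>i. \<bar>W (r i) x\<bar>) \<longlonglongrightarrow> 0"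
      using conv v0 by eventually_elim (auto intro: tendsto_rabs_zero)
  qed (auto simp: H_bound[OF W(1)])
  then have "(\<lambda>i. \<integral>x. \<bar>W (r i) x\<bar> \<partial>M) \<longlonglongrightarrow> 0" by simp
  from order_tendstoD(2)[OF this e] obtain i where "(\<integral>x. \<bar>W (r i) x\<bar> \<partial>M) < e"
    by (meson eventually_sequentially order_refl)
  with W(1) show ?thesis by blast
qed

end

section \<open>Means of bounded functions along orbits\<close>

lemma isCont_less_nbhd:
  fixes \<phi> :: "'g::t2_space \<Rightarrow> real"
  assumes "isCont \<phi> a" "\<phi> a < e"
  obtains V where "open V" "a \<in> V" "\<And>g. g \<in> V \<Longrightarrow> \<phi> g < e"
proof -
  obtain V where "open V" "a \<in> V" "\<forall>g\<in>V. \<phi> g \<in> {..<e}"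
    using assms continuous_at_open[of a \<phi>] by (metis lessThan_iff open_lessThan)
  then show ?thesis by (intro that) auto
qed

context lca_action begin

text \<open>Boundedness is required everywhere, not almost everywhere, so that the integrals along
  the orbit of every single point exist; functions that are only essentially bounded are reduced to
  these at the end.\<close>

definition bounded_measurable :: "('x \<Rightarrow> 'b::{banach, second_countable_topology}) set" where
  "bounded_measurable = {u \<in> borel_measurable M. bounded (range u)}"

lemma bounded_measurableI: "u \<in> borel_measurable M \<Longrightarrow> (\<And>x. norm (u x) \<le> B) \<Longrightarrow> u \<in> bounded_measurable"
  unfolding bounded_measurable_def bounded_iff by (intro CollectI conjI exI[of _ B]) simp_all

lemma bounded_measurable_imp_borel: "u \<in> bounded_measurable \<Longrightarrow> u \<in> borel_measurable M"
  by (simp add: bounded_measurable_def)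

lemma bounded_measurable_bound: "u \<in> bounded_measurable \<Longrightarrow> \<exists>B>0. \<forall>x. norm (u x) \<le> B"
  by (simp add: bounded_measurable_def bounded_pos)

lemma bounded_measurable_const: "(\<lambda>_. c) \<in> bounded_measurable"
  by (rule bounded_measurableI[of _ "norm c"]) auto

lemma bounded_measurable_act:
  assumes "u \<in> bounded_measurable" shows "(\<lambda>x. u (act g x)) \<in> bounded_measurable"
proof -
  note [measurable] = bounded_measurable_imp_borel[OF assms]
  obtain B where "B > 0" "\<And>x. norm (u x) \<le> B" using bounded_measurable_bound[OF assms] by blast
  moreover have "(\<lambda>x. u (act g x)) \<in> borel_measurable M" by measurable
  ultimately show ?thesis by (intro bounded_measurableI[of _ B])
qed

lemma bounded_measurable_linear:
  assumes T: "bounded_linear T" and "u \<in> bounded_measurable" shows "(\<lambda>x. T (u x)) \<in> bounded_measurable"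
proof -
  obtain B where B: "B > 0" "\<And>x. norm (u x) \<le> B" using bounded_measurable_bound[OF assms(2)] by blast
  obtain K where K: "K > 0" "\<And>y. norm (T y) \<le> norm y * K" using bounded_linear.pos_bounded[OF T] by blast
  have "T \<in> borel_measurable borel"
    by (intro borel_measurable_continuous_onI linear_continuous_on T)
  with bounded_measurable_imp_borel[OF assms(2)] have "(\<lambda>x. T (u x)) \<in> borel_measurable M"
    by (rule measurable_compose)
  moreover have "norm (T (u x)) \<le> B * K" for x
    using K(2)[of "u x"] mult_right_mono[OF B(2)[of x], of K] K(1) by linarith
  ultimately show ?thesis by (rule bounded_measurableI)
qed

lemma bounded_measurable_add:
  assumes "u \<in> bounded_measurable" "v \<in> bounded_measurable" shows "(\<lambda>x. u x + v x) \<in> bounded_measurable"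
proof -
  obtain B where B: "B > 0" "\<And>x. norm (u x) \<le> B" using bounded_measurable_bound[OF assms(1)] by blast
  obtain C where C: "C > 0" "\<And>x. norm (v x) \<le> C" using bounded_measurable_bound[OF assms(2)] by blast
  have "norm (u x + v x) \<le> B + C" for x by (intro norm_triangle_mono B(2) C(2))
  with borel_measurable_add[OF assms[THEN bounded_measurable_imp_borel]] show ?thesis by (rule bounded_measurableI)
qed

lemma bounded_measurable_diff:
  assumes "u \<in> bounded_measurable" "v \<in> bounded_measurable" shows "(\<lambda>x. u x - v x) \<in> bounded_measurable"
  using bounded_measurable_add[OF assms(1) bounded_measurable_linear[OF bounded_linear_minus[OF bounded_linear_ident] assms(2)]] by simp

lemma bounded_measurable_norm:
  assumes "u \<in> bounded_measurable" shows "(\<lambda>x. norm (u x)) \<in> bounded_measurable"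
proof -
  obtain B where "B > 0" "\<And>x. norm (u x) \<le> B" using bounded_measurable_bound[OF assms] by blast
  then show ?thesis
    using measurable_compose[OF bounded_measurable_imp_borel[OF assms] borel_measurable_norm] by (intro bounded_measurableI[of _ B]) simp_all
qed

lemma bounded_measurable_mult:
  fixes u v :: "'x \<Rightarrow> 'b::{real_normed_algebra, banach, second_countable_topology}"
  assumes "u \<in> bounded_measurable" "v \<in> bounded_measurable" shows "(\<lambda>x. u x * v x) \<in> bounded_measurable"
proof -
  obtain B where B: "B > 0" "\<And>x. norm (u x) \<le> B" using bounded_measurable_bound[OF assms(1)] by blast
  obtain C where C: "C > 0" "\<And>x. norm (v x) \<le> C" using bounded_measurable_bound[OF assms(2)] by blast
  have "norm (u x * v x) \<le> B * C" for x
    using B(1) by (intro order_trans[OF norm_mult_ineq] mult_mono B(2) C(2)) auto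
  with borel_measurable_times[OF assms[THEN bounded_measurable_imp_borel]] show ?thesis by (rule bounded_measurableI)
qed

lemma bounded_measurable_integrable: "u \<in> bounded_measurable \<Longrightarrow> integrable M u"
  using bounded_measurable_bound[of u] bounded_measurable_imp_borel[of u] by (blast intro: integrable_bounded)

text \<open>Finiteness is implicit: the real-valued \<open>measure\<close> is 0 on sets of infinite
  measure.\<close>

definition window :: "'g set \<Rightarrow> bool" where
  "window A \<longleftrightarrow> A \<in> sets m \<and> measure m A > 0"

lemma window_sets: "window A \<Longrightarrow> A \<in> sets m"
  and window_pos: "window A \<Longrightarrow> measure m A > 0"
  and window_finite: "window A \<Longrightarrow> emeasure m A < \<infinity>"
  by (auto simp: window_def measure_def enn2real_positive_iff)

definition orbit_mean :: "'g set \<Rightarrow> ('x \<Rightarrow> 'b::{banach, second_countable_topology}) \<Rightarrow> 'x \<Rightarrow> 'b" where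
  "orbit_mean A u x = (1 / measure m A) *\<^sub>R (LINT g:A|m. u (act g x))"

lemma orbit_measurable:
  assumes "u \<in> borel_measurable M" shows "(\<lambda>g. u (act g x)) \<in> borel_measurable m"
  by (rule measurable_compose[OF measurable_act assms]) (auto intro: measurable_ident)

lemma orbit_integrable:
  assumes A: "window A" and u: "u \<in> bounded_measurable"
  shows "set_integrable m A (\<lambda>g. u (act g x))"
proof -
  obtain B where "B > 0" "\<And>x. norm (u x) \<le> B" using bounded_measurable_bound[OF u] by blast
  then show ?thesis unfolding set_integrable_def
    using window_sets[OF A] window_finite[OF A] orbit_measurable[OF bounded_measurable_imp_borel[OF u]]
    by (intro integrableI_bounded_set_indicator[where B = B]) auto
qed

lemma orbit_mean_linear:
  assumes "window A" "u \<in> bounded_measurable" and T: "bounded_linear T"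
  shows "orbit_mean A (\<lambda>y. T (u y)) x = T (orbit_mean A u x)"
proof -
  interpret T: bounded_linear T by fact
  show ?thesis
    using integral_bounded_linear[OF T orbit_integrable[OF assms(1,2), unfolded set_integrable_def, of x]]
    by (simp add: orbit_mean_def set_lebesgue_integral_def T.scaleR)
qed

lemma orbit_mean_add:
  assumes "window A" "u \<in> bounded_measurable" "v \<in> bounded_measurable"
  shows "orbit_mean A (\<lambda>y. u y + v y) x = orbit_mean A u x + orbit_mean A v x"
  using orbit_integrable[OF assms(1,2)] orbit_integrable[OF assms(1,3)]
  by (simp add: orbit_mean_def set_integral_add scaleR_right_distrib)

lemma orbit_mean_diff:
  assumes "window A" "u \<in> bounded_measurable" "v \<in> bounded_measurable"
  shows "orbit_mean A (\<lambda>y. u y - v y) x = orbit_mean A u x - orbit_mean A v x"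
  using orbit_integrable[OF assms(1,2)] orbit_integrable[OF assms(1,3)]
  by (simp add: orbit_mean_def set_integral_diff scaleR_right_diff_distrib)

lemma orbit_mean_const:
  assumes "window A" shows "orbit_mean A (\<lambda>_. c) x = c"
  using window_sets[OF assms] window_pos[OF assms] window_finite[OF assms]
  by (simp add: orbit_mean_def set_lebesgue_integral_def)

lemma orbit_mean_mono:
  fixes u v :: "'x \<Rightarrow> real"
  assumes "window A" "u \<in> bounded_measurable" "v \<in> bounded_measurable" "\<And>y. u y \<le> v y"
  shows "orbit_mean A u x \<le> orbit_mean A v x"
  unfolding orbit_mean_def real_scaleR_def
  using orbit_integrable[OF assms(1,2)] orbit_integrable[OF assms(1,3)] assms(4)
  by (intro mult_left_mono set_integral_mono) auto

lemma norm_orbit_mean_le: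
  assumes "window A" "u \<in> bounded_measurable"
  shows "norm (orbit_mean A u x) \<le> orbit_mean A (\<lambda>y. norm (u y)) x"
  using set_integral_norm_bound[OF orbit_integrable[OF assms]]
  by (simp add: orbit_mean_def divide_right_mono)

text \<open>Commutativity of the group turns a shift of the base point into a shift of the
  function.\<close>

lemma orbit_mean_act: "orbit_mean A u (act h x) = orbit_mean A (\<lambda>y. u (act h y)) x"
proof -
  have "act g (act h x) = act h (act g x)" for g by (metis act_add add.commute)
  then show ?thesis by (simp add: orbit_mean_def)
qed

text \<open>Averaging over \<open>A\<close> from \<open>act h x\<close> is averaging over
  \<open>h + A\<close> from \<open>x\<close>, so only the symmetric difference of the two sets
  matters. This serves two ends: \<open>A\<close> a Folner set with \<open>h\<close> fixed, and
  \<open>A\<close> a fixed window with \<open>h\<close> near 0.\<close>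

lemma orbit_mean_shift_le:
  fixes u :: "'x \<Rightarrow> 'b::{banach, second_countable_topology}"
  assumes A: "window A" and u: "u \<in> borel_measurable M" "\<And>y. norm (u y) \<le> B"
  shows "norm (orbit_mean A u (act h x) - orbit_mean A u x)
    \<le> B * measure m (sym_diff ((+) (- h) -` A) A) / measure m A"
proof -
  let ?A = "(+) (- h) -` A"
  have A_sets [measurable]: "A \<in> sets m" and "emeasure m A < \<infinity>"
    using window_sets[OF A] window_finite[OF A] .
  have A'_sets [measurable]: "?A \<in> sets m"
    using measurable_sets[OF measurable_plus_left A_sets, of "- h"] by simp
  have "emeasure m ?A = emeasure m A"
    using emeasure_plus_image[OF A_sets, of h] by (simp add: plus_image)
  then have A': "window ?A" using A A'_sets by (simp add: window_def measure_def)
  have u_bm: "u \<in> bounded_measurable" using u by (rule bounded_measurableI)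
  have int: "integrable m (\<lambda>g. indicat_real C g *\<^sub>R u (act g x))" if "window C" for C
    using orbit_integrable[OF that u_bm] by (simp add: set_integrable_def)
  have fin: "emeasure m (sym_diff ?A A) < \<infinity>"
  proof -
    have "emeasure m (sym_diff ?A A) \<le> emeasure m (?A \<union> A)" by (intro emeasure_mono) auto
    also have "\<dots> \<le> emeasure m ?A + emeasure m A" by (rule emeasure_subadditive) auto
    also have "\<dots> < \<infinity>" using window_finite[OF A] window_finite[OF A'] by (simp add: less_top)
    finally show ?thesis .
  qed
  have [measurable]: "(\<lambda>g. u (act g x)) \<in> borel_measurable m" for x
    by (rule orbit_measurable[OF u(1)])
  have "(LINT g:A|m. u (act g (act h x))) = (\<integral>g. indicat_real A (- h + g) *\<^sub>R u (act (- h + g) (act h x)) \<partial>m)"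
    unfolding set_lebesgue_integral_def by (rule integral_plus[symmetric]) measurable
  also have "\<dots> = (LINT g:?A|m. u (act g x))"
    unfolding set_lebesgue_integral_def
    by (intro Bochner_Integration.integral_cong refl) (auto simp: indicator_def simp flip: act_add)
  finally have "norm ((LINT g:A|m. u (act g (act h x))) - (LINT g:A|m. u (act g x))) =
      norm (\<integral>g. indicat_real ?A g *\<^sub>R u (act g x) - indicat_real A g *\<^sub>R u (act g x) \<partial>m)"
    using int[OF A] int[OF A'] by (simp add: set_lebesgue_integral_def)
  also have "\<dots> \<le> (\<integral>g. norm (indicat_real ?A g *\<^sub>R u (act g x) - indicat_real A g *\<^sub>R u (act g x)) \<partial>m)"
    by (rule integral_norm_bound)
  also have "\<dots> \<le> (\<integral>g. B * indicat_real (sym_diff ?A A) g \<partial>m)"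
  proof (rule integral_mono)
    show "integrable m (\<lambda>g. norm (indicat_real ?A g *\<^sub>R u (act g x) - indicat_real A g *\<^sub>R u (act g x)))"
      using int[OF A] int[OF A'] by auto
    show "integrable m (\<lambda>g. B * indicat_real (sym_diff ?A A) g)" using fin by auto
    show "norm (indicat_real ?A g *\<^sub>R u (act g x) - indicat_real A g *\<^sub>R u (act g x))
        \<le> B * indicat_real (sym_diff ?A A) g" for g
      using u(2)[of "act g x"] by (auto simp: indicator_def)
  qed
  also have "\<dots> = B * measure m (sym_diff ?A A)" by simp
  finally have *: "norm ((LINT g:A|m. u (act g (act h x))) - (LINT g:A|m. u (act g x)))
      \<le> B * measure m (sym_diff ?A A)" .
  have "norm (orbit_mean A u (act h x) - orbit_mean A u x) =
      norm ((LINT g:A|m. u (act g (act h x))) - (LINT g:A|m. u (act g x))) / measure m A"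
    using window_pos[OF A] by (simp add: orbit_mean_def scaleR_right_diff_distrib[symmetric] del: scaleR_right_diff_distrib)
  then show ?thesis using * window_pos[OF A] by (simp add: divide_right_mono)
qed

lemma orbit_mean_bm:
  assumes A: "window A" and u: "u \<in> bounded_measurable" shows "orbit_mean A u \<in> bounded_measurable"
proof -
  obtain B where B: "B > 0" "\<And>x. norm (u x) \<le> B" using bounded_measurable_bound[OF u] by blast
  note [measurable] = bounded_measurable_imp_borel[OF u] window_sets[OF A]
  have "orbit_mean A u \<in> borel_measurable M"
    unfolding orbit_mean_def set_lebesgue_integral_def by measurable
  moreover have "norm (orbit_mean A u x) \<le> B" for x
  proof -
    have "norm (orbit_mean A u x) \<le> orbit_mean A (\<lambda>y. norm (u y)) x"
      by (rule norm_orbit_mean_le[OF A u])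
    also have "\<dots> \<le> orbit_mean A (\<lambda>_. B) x"
      by (intro orbit_mean_mono A bounded_measurable_norm u bounded_measurable_const B)
    finally show ?thesis by (simp add: orbit_mean_const[OF A])
  qed
  ultimately show ?thesis by (rule bounded_measurableI)
qed

text \<open>The difference from the mean is the mean over \<open>A\<close> of the differences from
  translates. Fubini bounds its L1 norm by the mean of the displacements.\<close>

lemma orbit_mean_L1_le:
  assumes A: "window A" and u: "u \<in> bounded_measurable" and e: "\<And>g. g \<in> A \<Longrightarrow> displacement u g \<le> e"
  shows "(\<integral>x. norm (u x - orbit_mean A u x) \<partial>M) \<le> e"
proof -
  note [measurable] = bounded_measurable_imp_borel[OF u] window_sets[OF A]
  obtain B where B: "B > 0" "\<And>x. norm (u x) \<le> B" using bounded_measurable_bound[OF u] by blast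
  define r where "r g x = indicat_real A g *\<^sub>R norm (u (act g x) - u x)" for g x
  have int: "integrable (m \<Otimes>\<^sub>M M) (\<lambda>(g, x). r g x)"
  proof -
    have "integrable (m \<Otimes>\<^sub>M M) (\<lambda>z. indicat_real (A \<times> UNIV) z *\<^sub>R norm (u (act (fst z) (snd z)) - u (snd z)))"
    proof (rule integrableI_bounded_set_indicator)
      have "A \<times> space M \<in> sets (m \<Otimes>\<^sub>M M)" by measurable
      then show "A \<times> UNIV \<in> sets (m \<Otimes>\<^sub>M M)" by simp
      have "emeasure (m \<Otimes>\<^sub>M M) (A \<times> space M) = emeasure m A * emeasure M (space M)"
        by (rule emeasure_pair_measure_Times) auto
      then show "emeasure (m \<Otimes>\<^sub>M M) (A \<times> UNIV) < \<infinity>"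
        using window_finite[OF A] emeasure_space_1 by simp
      have "norm (u y - u x) \<le> 2 * B" for x y
        using norm_triangle_ineq4[of "u y" "u x"] B(2)[of y] B(2)[of x] by linarith
      then show "AE z in m \<Otimes>\<^sub>M M. z \<in> A \<times> UNIV \<longrightarrow>
          norm (norm (u (act (fst z) (snd z)) - u (snd z))) \<le> 2 * B" by simp
    qed measurable
    then show ?thesis
      by (rule Bochner_Integration.integrable_cong[THEN iffD1, rotated 2])
         (auto simp: r_def indicator_def)
  qed
  have rM: "(\<lambda>x. \<integral>g. r g x \<partial>m) = (\<lambda>x. measure m A * orbit_mean A (\<lambda>y. norm (u y - u x)) x)"
    using window_pos[OF A] by (simp add: r_def orbit_mean_def set_lebesgue_integral_def)
  have le: "measure m A * norm (u x - orbit_mean A u x) \<le> (\<integral>g. r g x \<partial>m)" for x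
  proof -
    have "norm (u x - orbit_mean A u x) = norm (orbit_mean A (\<lambda>y. u y - u x) x)"
      by (subst orbit_mean_diff[OF A u bounded_measurable_const]) (simp add: orbit_mean_const[OF A] norm_minus_commute)
    also have "\<dots> \<le> orbit_mean A (\<lambda>y. norm (u y - u x)) x"
      by (rule norm_orbit_mean_le[OF A bounded_measurable_diff[OF u bounded_measurable_const]])
    finally show ?thesis using window_pos[OF A] by (simp add: fun_cong[OF rM])
  qed
  have int1: "integrable m (\<lambda>g. \<integral>x. r g x \<partial>M)"
    using P.integrable_fst'[OF int] by simp
  have int2: "integrable M (\<lambda>x. \<integral>g. r g x \<partial>m)"
    using P.integrable_snd[of r] int by simp
  have "measure m A * (\<integral>x. norm (u x - orbit_mean A u x) \<partial>M) =
      (\<integral>x. measure m A * norm (u x - orbit_mean A u x) \<partial>M)" by simp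
  also have "\<dots> \<le> (\<integral>x. (\<integral>g. r g x \<partial>m) \<partial>M)"
    using bounded_measurable_integrable[OF bounded_measurable_diff[OF u orbit_mean_bm[OF A u]]] le
    by (intro integral_mono int2) auto
  also have "\<dots> = (\<integral>g. (\<integral>x. r g x \<partial>M) \<partial>m)" by (rule P.Fubini_integral[OF int])
  also have "\<dots> \<le> (\<integral>g. indicat_real A g * e \<partial>m)"
    using e
    by (intro integral_mono int1 integrable_mult_left integrable_real_indicator
        window_sets[OF A] window_finite[OF A]) (auto simp: r_def displacement_def indicator_def)
  also have "\<dots> = measure m A * e" by simp
  finally show ?thesis using window_pos[OF A] by simp
qed

section \<open>Small windows around the identity\<close>

lemma emeasure_plus_vimage:
  assumes "B \<in> sets m" shows "emeasure m ((+) g -` B) = emeasure m B"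
  using emeasure_plus_image[OF assms, of "- g", unfolded plus_image] by simp

text \<open>Intersecting with a relatively compact neighbourhood makes the measure finite. The
  window is kept open, which gives it positive measure and lets \<open>window_shift_small\<close>
  apply to it.\<close>

lemma small_window:
  assumes "u \<in> bounded_measurable" "e > 0"
  obtains U where "open U" "window U" "(\<integral>x. norm (u x - orbit_mean U u x) \<partial>M) \<le> e"
proof -
  have "isCont (displacement u) 0"
  proof (rule continuous_at_sequentiallyI)
    fix a :: "nat \<Rightarrow> 'g" assume "a \<longlonglongrightarrow> 0"
    then show "(\<lambda>n. displacement u (a n)) \<longlonglongrightarrow> displacement u 0"
      using displacement_tendsto_0[OF _ bounded_measurable_integrable[OF assms(1)]] by (simp add: displacement_def)
  qed
  moreover have "displacement u 0 < e" using assms(2) by (simp add: displacement_def)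
  ultimately obtain V where V: "open V" "0 \<in> V" "\<And>g. g \<in> V \<Longrightarrow> displacement u g < e"
    by (rule isCont_less_nbhd) blast
  obtain W K where W: "open W" "compact K" "(0::'g) \<in> W" "W \<subseteq> K" by (rule relatively_compact_nbhd)
  have op: "open (V \<inter> W)" using V W by auto
  have "emeasure m (V \<inter> W) \<le> emeasure m K"
    using W(4) compact_measurable[OF W(2)] by (intro emeasure_mono) auto
  then have "emeasure m (V \<inter> W) < \<infinity>" using emeasure_compact[OF W(2)] by (rule le_less_trans)
  moreover have "emeasure m (V \<inter> W) \<noteq> 0" using V(2) W(3) by (intro emeasure_open_pos op) auto
  ultimately have win: "window (V \<inter> W)"
    using op by (auto simp: window_def sets_m measure_def enn2real_positive_iff zero_less_iff_neq_zero)
  show ?thesis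
    using V(3) by (intro that[OF op win] orbit_mean_L1_le[OF win assms(1)]) (auto intro: less_imp_le)
qed

text \<open>This is \<open>measure_translate_open\<close> for the group acting on itself by
  translations, with Haar measure in place of \<open>M\<close>.\<close>

lemma window_shift_small:
  assumes U: "open U" "window U" and e: "e > 0"
  obtains V where "open V" "0 \<in> V" "\<And>h. h \<in> V \<Longrightarrow> measure m (sym_diff ((+) (- h) -` U) U) < e"
proof -
  have zero: "measure m (sym_diff ((+) (- 0) -` U) U) = 0"
  proof -
    have "sym_diff ((+) (- 0) -` U) U = {}" by auto
    then show ?thesis by (simp only: measure_empty)
  qed
  have "isCont (\<lambda>h. measure m (sym_diff ((+) (- h) -` U) U)) 0"
  proof (rule continuous_at_sequentiallyI)
    fix a :: "nat \<Rightarrow> 'g" assume "a \<longlonglongrightarrow> 0"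
    then have "(\<lambda>n. measure m (sym_diff ((+) (- a n) -` U) U)) \<longlonglongrightarrow> 0"
      using U(1) window_finite[OF U(2)] window_sets[OF U(2)] measurable_sets[OF measurable_plus_left, of U]
      by (intro measure_translate_open[of m U "\<lambda>g. (+) (- g)"] continuous_intros)
         (auto simp: sets_m emeasure_plus_vimage)
    then show "(\<lambda>n. measure m (sym_diff ((+) (- a n) -` U) U)) \<longlonglongrightarrow>
        measure m (sym_diff ((+) (- 0) -` U) U)" unfolding zero .
  qed
  then show ?thesis by (rule isCont_less_nbhd) (use e zero that in auto)
qed

end

section \<open>Pointwise convergence\<close>

context folner_action begin

lemma F_window: "window (F n)"
  using F_pos by (simp add: window_def)

abbreviation avg :: "nat \<Rightarrow> ('x \<Rightarrow> 'b::{banach, second_countable_topology}) \<Rightarrow> 'x \<Rightarrow> 'b" where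
  "avg n \<equiv> orbit_mean (F n)"

text \<open>For the two-point set \<open>{0, - h}\<close> the Folner boundary is precisely the
  symmetric difference in \<open>orbit_mean_shift_le\<close>. The convergence holds at every
  \<open>x\<close>.\<close>

lemma avg_shift:
  assumes "u \<in> bounded_measurable" shows "(\<lambda>n. avg n u (act h x) - avg n u x) \<longlonglongrightarrow> 0"
proof -
  obtain B where B: "B > 0" "\<And>x. norm (u x) \<le> B" using bounded_measurable_bound[OF assms] by blast
  have bd: "boundary {0, - h} (F n) = sym_diff ((+) (- h) -` F n) (F n)" for n
    by (auto simp: boundary_def)
  have "(\<lambda>n. measure m (boundary {0, - h} (F n)) / measure m (F n)) \<longlonglongrightarrow> 0"
    using folner unfolding strong_folner_sequence_def by (auto intro: finite_imp_compact)
  from tendsto_mult[OF tendsto_const[of B] this]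
  have lim: "(\<lambda>n. B * measure m (sym_diff ((+) (- h) -` F n) (F n)) / measure m (F n)) \<longlonglongrightarrow> 0"
    by (simp add: bd)
  show ?thesis
    by (rule Lim_null_comparison[OF always_eventually lim])
       (intro allI orbit_mean_shift_le F_window bounded_measurable_imp_borel assms B(2))
qed

lemma avg_orbit_average:
  assumes "w \<in> orbit_averages act u" and u: "u \<in> bounded_measurable"
  shows "(\<lambda>n. avg n w x - avg n u x) \<longlonglongrightarrow> 0"
  using assms(1)
proof induct
  case (base g)
  show ?case using avg_shift[OF u, of g x] by (simp add: orbit_mean_act)
next
  case (mid v w)
  obtain B where B: "B > 0" "\<And>x. norm (u x) \<le> B" using bounded_measurable_bound[OF u] by blast
  have avgs: "w \<in> bounded_measurable" if "w \<in> orbit_averages act u" for w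
    using orbit_averages_measurable[OF that bounded_measurable_imp_borel[OF u]]
      orbit_averages_bound[OF that, of B] B(2) by (intro bounded_measurableI[of _ B]) auto
  have "avg n (\<lambda>x. (v x + w x) / 2) x = (avg n v x + avg n w x) / 2" for n
    using orbit_mean_linear[OF F_window bounded_measurable_add[OF avgs[OF mid(1)] avgs[OF mid(3)]]
        bounded_linear_divide, of n 2 x]
    by (simp add: orbit_mean_add[OF F_window avgs[OF mid(1)] avgs[OF mid(3)]])
  then have eq: "avg n (\<lambda>x. (v x + w x) / 2) x - avg n u x =
      ((avg n v x - avg n u x) + (avg n w x - avg n u x)) / 2" for n
    by (simp add: field_simps)
  have "(\<lambda>n. ((avg n v x - avg n u x) + (avg n w x - avg n u x)) / 2) \<longlonglongrightarrow> (0 + 0) / 2"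
    by (intro tendsto_intros mid) simp
  then show ?case unfolding eq by simp
qed

text \<open>If the averages of \<open>u\<close> are large infinitely often at \<open>x\<close>, then
  some average of \<open>w\<close> is at least half as large, for any orbit average \<open>w\<close>
  of \<open>u\<close>. The maximal inequality makes this improbable once \<open>w\<close> has small
  L1 norm.\<close>

lemma pointwise_ergodic_mean_0:
  fixes u :: "'x \<Rightarrow> real"
  assumes u: "u \<in> bounded_measurable" and u0: "(\<integral>x. u x \<partial>M) = 0"
  shows "AE x in M. (\<lambda>n. avg n u x) \<longlonglongrightarrow> 0"
proof -
  obtain B where B: "B > 0" "\<And>x. \<bar>u x\<bar> \<le> B" using bounded_measurable_bound[OF u] by auto
  obtain C where C: "C > 0" "\<And>\<phi> \<theta>. \<phi> \<in> borel_measurable M \<Longrightarrow>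
      \<theta> * emeasure M {x. \<exists>n. \<theta> * emeasure m (F n) \<le> (\<integral>\<^sup>+g. indicator (F n) g * \<phi> (act g x) \<partial>m)}
        \<le> ennreal C * (\<integral>\<^sup>+x. \<phi> x \<partial>M)" by (rule maximal_inequality) blast
  note [measurable] = bounded_measurable_imp_borel[OF u]
  have avg_meas [measurable]: "avg n u \<in> borel_measurable M" for n
    by (rule bounded_measurable_imp_borel[OF orbit_mean_bm[OF F_window u]])
  have bad: "AE x in M. \<exists>N. \<forall>n\<ge>N. \<bar>avg n u x\<bar> < \<delta>" if \<delta>: "\<delta> > 0" for \<delta>
  proof -
    define Z where "Z = {x\<in>space M. \<not> (\<exists>N. \<forall>n\<ge>N. \<bar>avg n u x\<bar> < \<delta>)}"
    have Z [measurable]: "Z \<in> sets M" unfolding Z_def by measurable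
    have Z_le: "\<delta> / 2 * prob Z \<le> C * e" if e: "e > 0" for e
    proof -
      obtain w where w: "w \<in> orbit_averages act u" "(\<integral>x. \<bar>w x\<bar> \<partial>M) < e"
        using mean_ergodic[OF ergodic bounded_measurable_imp_borel[OF u] B(2) u0 e] by blast
      have w_bm: "w \<in> bounded_measurable"
        using orbit_averages_measurable[OF w(1) bounded_measurable_imp_borel[OF u]]
          orbit_averages_bound[OF w(1) B(2)] by (intro bounded_measurableI[of _ B]) auto
      note [measurable] = bounded_measurable_imp_borel[OF w_bm]
      let ?L = "{x. \<exists>n. ennreal (\<delta> / 2) * emeasure m (F n) \<le>
          (\<integral>\<^sup>+g. indicator (F n) g * ennreal \<bar>w (act g x)\<bar> \<partial>m)}"
      \<comment> \<open>Points of \<open>Z\<close> have averages of size at least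
        \<open>\<delta>\<close> at arbitrarily late times, in particular after the averages of
        \<open>w\<close> and \<open>u\<close> have come within \<open>\<delta> / 2\<close>.\<close>
      have "Z \<subseteq> ?L"
      proof
        fix x assume x: "x \<in> Z"
        have "eventually (\<lambda>n. \<bar>avg n w x - avg n u x\<bar> < \<delta> / 2) sequentially"
          using tendstoD[OF avg_orbit_average[OF w(1) u], of "\<delta> / 2" x] \<delta> by (simp add: dist_real_def)
        then obtain N where N: "\<And>n. n \<ge> N \<Longrightarrow> \<bar>avg n w x - avg n u x\<bar> < \<delta> / 2"
          by (auto simp: eventually_sequentially)
        from x obtain n where n: "n \<ge> N" "\<bar>avg n u x\<bar> \<ge> \<delta>"
          unfolding Z_def by (auto simp: not_less)
        have "\<delta> / 2 \<le> \<bar>avg n w x\<bar>" using N[OF n(1)] n(2) by linarith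
        also have "\<dots> \<le> avg n (\<lambda>y. \<bar>w y\<bar>) x"
          using norm_orbit_mean_le[OF F_window w_bm, of n x] by simp
        finally have "\<delta> / 2 * measure m (F n) \<le> (LINT g:F n|m. \<bar>w (act g x)\<bar>)"
          using F_pos[of n] by (simp add: orbit_mean_def field_simps)
        then have "ennreal (\<delta> / 2 * measure m (F n)) \<le> ennreal (\<integral>g. indicat_real (F n) g * \<bar>w (act g x)\<bar> \<partial>m)"
          by (intro ennreal_leI) (simp add: set_lebesgue_integral_def)
        also have "\<dots> = (\<integral>\<^sup>+g. ennreal (indicat_real (F n) g * \<bar>w (act g x)\<bar>) \<partial>m)"
          using orbit_integrable[OF F_window bounded_measurable_norm[OF w_bm], of n x]
          by (intro nn_integral_eq_integral[symmetric]) (auto simp: set_integrable_def)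
        also have "\<dots> = (\<integral>\<^sup>+g. indicator (F n) g * ennreal \<bar>w (act g x)\<bar> \<partial>m)"
          by (intro nn_integral_cong) (auto simp: indicator_def)
        also have "ennreal (\<delta> / 2 * measure m (F n)) = ennreal (\<delta> / 2) * emeasure m (F n)"
          unfolding emeasure_F using \<delta> by (intro ennreal_mult) auto
        finally have "ennreal (\<delta> / 2) * emeasure m (F n) \<le>
            (\<integral>\<^sup>+g. indicator (F n) g * ennreal \<bar>w (act g x)\<bar> \<partial>m)" .
        then show "x \<in> ?L" by blast
      qed
      moreover have "?L \<in> sets M"
      proof -
        have "{x\<in>space M. \<exists>n. ennreal (\<delta> / 2) * emeasure m (F n) \<le>
          (\<integral>\<^sup>+g. indicator (F n) g * ennreal \<bar>w (act g x)\<bar> \<partial>m)} \<in> sets M" by measurable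
        then show ?thesis by simp
      qed
      ultimately have ZL: "emeasure M Z \<le> emeasure M ?L" by (rule emeasure_mono)
      have "ennreal (\<delta> / 2 * prob Z) = ennreal (\<delta> / 2) * emeasure M Z"
        unfolding emeasure_eq_measure using \<delta> by (intro ennreal_mult) auto
      also have "\<dots> \<le> ennreal (\<delta> / 2) * emeasure M ?L" by (intro mult_left_mono ZL) simp
      also have "\<dots> \<le> ennreal C * (\<integral>\<^sup>+x. ennreal \<bar>w x\<bar> \<partial>M)" by (rule C(2)) measurable
      also have "(\<integral>\<^sup>+x. ennreal \<bar>w x\<bar> \<partial>M) = ennreal (\<integral>x. \<bar>w x\<bar> \<partial>M)"
        using bounded_measurable_integrable[OF w_bm] by (intro nn_integral_eq_integral) auto
      also have "ennreal C * \<dots> \<le> ennreal C * ennreal e"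
        using w(2) by (intro mult_left_mono ennreal_leI) auto
      also have "\<dots> = ennreal (C * e)" using C(1) e by (intro ennreal_mult[symmetric]) auto
      finally show ?thesis using C(1) e by (subst (asm) ennreal_le_iff) auto
    qed
    have "prob Z = 0"
    proof (rule ccontr)
      assume "prob Z \<noteq> 0"
      then have p: "prob Z > 0" by (simp add: zero_less_measure_iff)
      \<comment> \<open>The choice of \<open>e\<close> makes \<open>C * e\<close> half of the
        left-hand side of \<open>Z_le\<close>.\<close>
      then have "\<delta> / 2 * prob Z \<le> \<delta> / 4 * prob Z"
        using Z_le[of "\<delta> / 4 * prob Z / C"] \<delta> C(1) by simp
      with p \<delta> show False by simp
    qed
    then have "AE x in M. x \<notin> Z" using Z by (intro AE_not_in) (simp add: null_setsI emeasure_eq_measure)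
    then show ?thesis by (auto simp: Z_def)
  qed
  have "AE x in M. \<forall>k. \<exists>N. \<forall>n\<ge>N. \<bar>avg n u x\<bar> < 1 / real (Suc k)"
    by (intro AE_all_countable[THEN iffD2] allI bad) simp
  then show ?thesis
  proof eventually_elim
    fix x assume x: "\<forall>k. \<exists>N. \<forall>n\<ge>N. \<bar>avg n u x\<bar> < 1 / real (Suc k)"
    show "(\<lambda>n. avg n u x) \<longlonglongrightarrow> 0"
    proof (rule LIMSEQ_I)
      fix r :: real assume "r > 0"
      then obtain k where k: "1 / real (Suc k) < r" using nat_approx_posE by blast
      obtain N where "\<forall>n\<ge>N. \<bar>avg n u x\<bar> < 1 / real (Suc k)" using x by blast
      with k show "\<exists>N. \<forall>n\<ge>N. norm (avg n u x - 0) < r" by (intro exI[of _ N]) force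
    qed
  qed
qed

theorem pointwise_ergodic_real:
  fixes u :: "'x \<Rightarrow> real"
  assumes u: "u \<in> bounded_measurable"
  shows "AE x in M. (\<lambda>n. avg n u x) \<longlonglongrightarrow> (\<integral>x. u x \<partial>M)"
proof -
  let ?c = "\<integral>x. u x \<partial>M"
  have "(\<integral>x. u x - ?c \<partial>M) = 0"
    using bounded_measurable_integrable[OF u] prob_space by simp
  then have "AE x in M. (\<lambda>n. avg n (\<lambda>x. u x - ?c) x) \<longlonglongrightarrow> 0"
    by (intro pointwise_ergodic_mean_0 bounded_measurable_diff u bounded_measurable_const)
  then show ?thesis
    by eventually_elim
       (simp add: orbit_mean_diff[OF F_window u bounded_measurable_const] orbit_mean_const[OF F_window] LIM_zero_iff)
qed

theorem pointwise_ergodic: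
  fixes u :: "'x \<Rightarrow> complex"
  assumes u: "u \<in> bounded_measurable"
  shows "AE x in M. (\<lambda>n. avg n u x) \<longlonglongrightarrow> (\<integral>x. u x \<partial>M)"
  using pointwise_ergodic_real[OF bounded_measurable_linear[OF bounded_linear_Re u]]
    pointwise_ergodic_real[OF bounded_measurable_linear[OF bounded_linear_Im u]]
proof eventually_elim
  case (elim x)
  then show ?case
    using bounded_measurable_integrable[OF u]
    by (simp add: orbit_mean_linear[OF F_window u bounded_linear_Re]
        orbit_mean_linear[OF F_window u bounded_linear_Im] tendsto_complex_iff)
qed

section \<open>Correlations for all group elements\<close>

lemma correlation_bm:
  fixes f :: "'x \<Rightarrow> complex"
  assumes "f \<in> bounded_measurable" shows "(\<lambda>x. f (act h x) * cnj (f x)) \<in> bounded_measurable"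
  by (intro bounded_measurable_mult bounded_measurable_act bounded_measurable_linear[OF bounded_linear_cnj] assms)

text \<open>
  For uncountably many \<open>h\<close> the exceptional sets are controlled by replacing \<open>f\<close> with its mean
  over a small window \<open>U\<close>: the error \<open>d = |f - f\<^sub>U|\<close> has small averages along translates by every
  \<open>h\<close> because of the Folner property, while \<open>f\<^sub>U\<close> varies uniformly continuously along orbits.
\<close>

theorem correlation_averages:
  fixes f :: "'x \<Rightarrow> complex"
  assumes f: "f \<in> bounded_measurable"
  shows "AE x in M. \<forall>h. (\<lambda>n. avg n (\<lambda>y. f (act h y) * cnj (f y)) x) \<longlonglongrightarrow>
    (\<integral>y. f (act h y) * cnj (f y) \<partial>M)"
proof -
  define p where "p h y = f (act h y) * cnj (f y)" for h y
  have p: "p h \<in> bounded_measurable" for h unfolding p_def by (rule correlation_bm[OF f])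
  obtain B where B: "B > 0" "\<And>x. norm (f x) \<le> B" using bounded_measurable_bound[OF f] by blast
  have "\<exists>U. open U \<and> window U \<and> (\<integral>x. norm (f x - orbit_mean U f x) \<partial>M) \<le> 1 / real (Suc j)" for j
    by (rule small_window[OF f, of "1 / real (Suc j)"]) auto
  then obtain U where U: "\<And>j. open (U j)" "\<And>j. window (U j)"
      "\<And>j. (\<integral>x. norm (f x - orbit_mean (U j) f x) \<partial>M) \<le> 1 / real (Suc j)" by metis
  define d where "d j x = norm (f x - orbit_mean (U j) f x)" for j x
  have d: "d j \<in> bounded_measurable" for j
    unfolding d_def by (intro bounded_measurable_norm bounded_measurable_diff f orbit_mean_bm U)
  obtain D :: "'g set" where D: "countable D" "\<And>X. open X \<Longrightarrow> X \<noteq> {} \<Longrightarrow> \<exists>k\<in>D. k \<in> X"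
    by (rule countable_dense_setE) blast
  \<comment> \<open>These countably many limits are the only source of exceptional points; the rest
    of the argument runs at a fixed \<open>x\<close>.\<close>
  have "AE x in M. \<forall>k\<in>D. (\<lambda>n. avg n (p k) x) \<longlonglongrightarrow> (\<integral>y. p k y \<partial>M)"
    by (intro AE_ball_countable[THEN iffD2] D(1) ballI pointwise_ergodic p)
  moreover have "AE x in M. \<forall>j. (\<lambda>n. avg n (d j) x) \<longlonglongrightarrow> (\<integral>y. d j y \<partial>M)"
    by (intro AE_all_countable[THEN iffD2] allI pointwise_ergodic_real d)
  ultimately have "AE x in M. \<forall>h. (\<lambda>n. avg n (p h) x) \<longlonglongrightarrow> (\<integral>y. p h y \<partial>M)"
  proof eventually_elim
    case (elim x)
    show ?case
    proof (intro allI LIMSEQ_I)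
      fix h and r :: real assume r: "r > 0"
      \<comment> \<open>The three errors below are \<open>3 * B * \<eta>\<close>,
        \<open>\<eta>\<close> and \<open>3 * B * \<eta>\<close>; their sum stays strictly below
        \<open>8 * (B + 1) * \<eta> = r\<close>.\<close>
      define \<eta> where "\<eta> = r / (8 * (B + 1))"
      have "\<eta> > 0" "r = 8 * (B + 1) * \<eta>" using r B(1) by (simp_all add: \<eta>_def)
      then have "\<eta> > 0" "r = 8 * (B * \<eta>) + 8 * \<eta>" by (simp_all add: algebra_simps)
      moreover from this have "B * \<eta> > 0" using B(1) by simp
      ultimately have \<eta>: "\<eta> > 0" "7 * B * \<eta> + \<eta> < r" by simp_all
      obtain j where j: "1 / real (Suc j) < \<eta>" using nat_approx_posE[OF \<eta>(1)] .
      have dj: "(\<integral>y. d j y \<partial>M) < \<eta>" using U(3)[of j] j by (simp add: d_def)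
      define \<mu> where "\<mu> = measure m (U j)"
      have \<mu>: "\<mu> > 0" using window_pos[OF U(2)] by (simp add: \<mu>_def)
      \<comment> \<open>With this tolerance the bound \<open>B * measure m (...) / \<mu>\<close> of
        \<open>orbit_mean_shift_le\<close> becomes \<open>\<eta>\<close>.\<close>
      have "\<mu> * \<eta> / B > 0" using \<mu> \<eta>(1) B(1) by simp
      from window_shift_small[OF U(1,2) this, of j] obtain V where V: "open V" "0 \<in> V"
        "\<And>k. k \<in> V \<Longrightarrow> measure m (sym_diff ((+) (- k) -` U j) (U j)) < \<mu> * \<eta> / B" by blast
      have "open ((\<lambda>k. h - k) -` V)" by (intro open_vimage V(1) continuous_intros)
      moreover have "h \<in> (\<lambda>k. h - k) -` V" using V(2) by simp
      ultimately obtain k where k: "k \<in> D" "h - k \<in> V" using D(2)[of "(\<lambda>k. h - k) -` V"] by blast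
      have smooth: "norm (orbit_mean (U j) f (act h y) - orbit_mean (U j) f (act k y)) \<le> \<eta>" for y
      proof -
        have "act h y = act (h - k) (act k y)" by (simp flip: act_add)
        then have "norm (orbit_mean (U j) f (act h y) - orbit_mean (U j) f (act k y)) \<le>
            B * measure m (sym_diff ((+) (- (h - k)) -` U j) (U j)) / \<mu>"
          using orbit_mean_shift_le[OF U(2) bounded_measurable_imp_borel[OF f] B(2), of j "h - k" "act k y"]
          by (simp add: \<mu>_def)
        also have "\<dots> \<le> B * (\<mu> * \<eta> / B) / \<mu>"
          using V(3)[OF k(2)] B(1) \<mu> by (intro divide_right_mono mult_left_mono) auto
        also have "\<dots> = \<eta>" using B(1) \<mu> by simp
        finally show ?thesis .
      qed
      \<comment> \<open>\<open>q\<close> dominates the difference of the correlations at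
        \<open>h\<close> and \<open>k\<close>: two errors of replacing \<open>f\<close> by its mean,
        and the change \<open>\<eta>\<close> of the mean. It controls both the averages and the
        integrals.\<close>
      define q where "q y = B * (d j (act h y) + d j (act k y) + \<eta>)" for y
      have q: "q \<in> bounded_measurable"
        unfolding q_def by (intro bounded_measurable_mult bounded_measurable_add bounded_measurable_const bounded_measurable_act d)
      have pq: "norm (p h y - p k y) \<le> q y" for y
      proof -
        let ?s = "orbit_mean (U j) f"
        have "norm (f (act h y) - f (act k y)) =
            norm ((f (act h y) - ?s (act h y)) + (?s (act h y) - ?s (act k y)) - (f (act k y) - ?s (act k y)))"
          by simp
        also have "\<dots> \<le> d j (act h y) + norm (?s (act h y) - ?s (act k y)) + d j (act k y)"
          unfolding d_def
          by (intro order_trans[OF norm_triangle_ineq4] add_right_mono norm_triangle_ineq)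
        also have "\<dots> \<le> d j (act h y) + \<eta> + d j (act k y)" using smooth[of y] by simp
        finally have "norm (f (act h y) - f (act k y)) * norm (f y) \<le> (d j (act h y) + \<eta> + d j (act k y)) * B"
          using B(2)[of y] by (intro mult_mono) (auto simp: d_def intro: order_trans[OF norm_ge_zero])
        moreover have "p h y - p k y = (f (act h y) - f (act k y)) * cnj (f y)"
          by (simp add: p_def algebra_simps)
        ultimately show ?thesis by (simp add: q_def norm_mult mult_ac add_ac)
      qed
      have q_avg: "avg n q x = B * (avg n (d j) (act h x) + avg n (d j) (act k x) + \<eta>)" for n
      proof -
        have "avg n q x = B * avg n (\<lambda>y. d j (act h y) + d j (act k y) + \<eta>) x"
          unfolding q_def
          by (rule orbit_mean_linear[OF F_window _ bounded_linear_mult_right])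
             (intro bounded_measurable_add bounded_measurable_const bounded_measurable_act d)
        then show ?thesis
          by (simp add: orbit_mean_add[OF F_window] bounded_measurable_add bounded_measurable_const bounded_measurable_act d
              orbit_mean_const[OF F_window] orbit_mean_act)
      qed
      \<comment> \<open>Convergence is known at \<open>x\<close> alone; \<open>avg_shift\<close>
        carries it to \<open>act g x\<close> for every \<open>g\<close>, so the uncountably many
        \<open>h\<close> need no further null sets.\<close>
      have d_lim: "(\<lambda>n. avg n (d j) (act g x)) \<longlonglongrightarrow> (\<integral>y. d j y \<partial>M)" for g
        using tendsto_add[OF avg_shift[OF d, of j g x] elim(2)[rule_format, of j]] by simp
      have "(\<lambda>n. avg n q x) \<longlonglongrightarrow> B * ((\<integral>y. d j y \<partial>M) + (\<integral>y. d j y \<partial>M) + \<eta>)"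
        unfolding q_avg by (intro tendsto_intros d_lim)
      moreover have q3: "B * ((\<integral>y. d j y \<partial>M) + (\<integral>y. d j y \<partial>M) + \<eta>) < B * (3 * \<eta>)"
        using dj B(1) by (intro mult_strict_left_mono) auto
      ultimately have "eventually (\<lambda>n. avg n q x < B * (3 * \<eta>)) sequentially"
        by (rule order_tendstoD(2))
      moreover have "eventually (\<lambda>n. norm (avg n (p k) x - (\<integral>y. p k y \<partial>M)) < \<eta>) sequentially"
        using tendstoD[OF elim(1)[rule_format, OF k(1)] \<eta>(1)] by (simp add: dist_norm)
      ultimately have "eventually (\<lambda>n. norm (avg n (p h) x - (\<integral>y. p h y \<partial>M)) < r) sequentially"
      proof eventually_elim
        case (elim n)
        have "norm (avg n (p h) x - avg n (p k) x) = norm (avg n (\<lambda>y. p h y - p k y) x)"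
          by (simp add: orbit_mean_diff[OF F_window p p])
        also have "\<dots> \<le> avg n (\<lambda>y. norm (p h y - p k y)) x"
          by (intro norm_orbit_mean_le F_window bounded_measurable_diff p)
        also have "\<dots> \<le> avg n q x"
          by (intro orbit_mean_mono F_window bounded_measurable_norm bounded_measurable_diff p q pq)
        finally have 1: "norm (avg n (p h) x - avg n (p k) x) \<le> B * (3 * \<eta>)" using elim(1) by simp
        have "norm ((\<integral>y. p h y \<partial>M) - (\<integral>y. p k y \<partial>M)) = norm (\<integral>y. p h y - p k y \<partial>M)"
          by (simp add: bounded_measurable_integrable p)
        also have "\<dots> \<le> (\<integral>y. norm (p h y - p k y) \<partial>M)" by (rule integral_norm_bound)
        also have "\<dots> \<le> (\<integral>y. q y \<partial>M)"
          by (intro integral_mono bounded_measurable_integrable bounded_measurable_norm bounded_measurable_diff p q pq)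
        also have "\<dots> = B * ((\<integral>y. d j (act h y) \<partial>M) + (\<integral>y. d j (act k y) \<partial>M) + \<eta>)"
          unfolding q_def using bounded_measurable_integrable[OF bounded_measurable_act[OF d]] prob_space by simp
        also have "\<dots> \<le> B * (3 * \<eta>)"
          using q3 by (simp add: integral_act[OF bounded_measurable_imp_borel[OF d]])
        finally have 2: "norm ((\<integral>y. p h y \<partial>M) - (\<integral>y. p k y \<partial>M)) \<le> B * (3 * \<eta>)" .
        have "avg n (p h) x - (\<integral>y. p h y \<partial>M) = (avg n (p h) x - avg n (p k) x) +
            (avg n (p k) x - (\<integral>y. p k y \<partial>M)) - ((\<integral>y. p h y \<partial>M) - (\<integral>y. p k y \<partial>M))" by simp
        then have "norm (avg n (p h) x - (\<integral>y. p h y \<partial>M)) \<le> norm (avg n (p h) x - avg n (p k) x) +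
            norm (avg n (p k) x - (\<integral>y. p k y \<partial>M)) + norm ((\<integral>y. p h y \<partial>M) - (\<integral>y. p k y \<partial>M))"
          by (metis (no_types, lifting) norm_triangle_ineq4 norm_triangle_ineq order_trans add_right_mono)
        also have "\<dots> < B * (3 * \<eta>) + \<eta> + B * (3 * \<eta>)" using 1 2 elim(2) by linarith
        also have "\<dots> \<le> 7 * B * \<eta> + \<eta>" using B(1) \<eta>(1) by simp
        also have "\<dots> < r" by (rule \<eta>(2))
        finally show ?case .
      qed
      then show "\<exists>N. \<forall>n\<ge>N. norm (avg n (p h) x - (\<integral>y. p h y \<partial>M)) < r"
        by (simp add: eventually_sequentially)
    qed
  qed
  then show ?thesis unfolding p_def .
qed

text \<open>The averages sample \<open>f\<close> along an orbit, so changing \<open>f\<close> on a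
  null set of X must be justified: by Fubini, for almost every \<open>x\<close> the orbit meets the
  changed set only for a null set of \<open>g\<close>.\<close>

theorem correlation_averages_essentially_bounded:
  fixes f :: "'x \<Rightarrow> complex"
  assumes f: "f \<in> borel_measurable M" and bound: "AE x in M. norm (f x) \<le> B" "B \<ge> 0"
  shows "AE x in M. \<forall>h. (\<lambda>n. avg n (\<lambda>y. f (act h y) * cnj (f y)) x) \<longlonglongrightarrow>
    (\<integral>y. f (act h y) * cnj (f y) \<partial>M)"
proof -
  note [measurable] = f
  have cnj_meas: "(\<lambda>z. cnj (u z)) \<in> borel_measurable N" if "u \<in> borel_measurable N" for N u
    using that by (rule measurable_compose)
      (intro borel_measurable_continuous_onI linear_continuous_on bounded_linear_cnj)
  define f' where "f' x = (if norm (f x) \<le> B then f x else 0)" for x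
  have f'_meas [measurable]: "f' \<in> borel_measurable M" unfolding f'_def by measurable
  have f': "f' \<in> bounded_measurable" using f'_meas bound(2) by (intro bounded_measurableI[of _ B]) (auto simp: f'_def)
  have eq: "AE x in M. f x = f' x" using bound(1) by eventually_elim (simp add: f'_def)
  have eq_int: "(\<integral>y. f (act h y) * cnj (f y) \<partial>M) = (\<integral>y. f' (act h y) * cnj (f' y) \<partial>M)" for h
  proof (rule integral_cong_AE)
    show "AE y in M. f (act h y) * cnj (f y) = f' (act h y) * cnj (f' y)"
      using eq AE_act[OF eq, of h] by eventually_elim simp
    show "(\<lambda>y. f (act h y) * cnj (f y)) \<in> borel_measurable M"
      by (intro borel_measurable_times cnj_meas) measurable
    show "(\<lambda>y. f' (act h y) * cnj (f' y)) \<in> borel_measurable M"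
      by (rule bounded_measurable_imp_borel[OF correlation_bm[OF f']])
  qed
  have "AE g in m. AE x in M. f (act g x) = f' (act g x)"
    by (rule AE_I2) (rule AE_act[OF eq])
  then have "AE x in M. AE g in m. f (act g x) = f' (act g x)"
    by (subst P.AE_commute[symmetric]) measurable
  with correlation_averages[OF f'] show ?thesis
  proof eventually_elim
    case (elim x)
    have "avg n (\<lambda>y. f (act h y) * cnj (f y)) x = avg n (\<lambda>y. f' (act h y) * cnj (f' y)) x" for n h
    proof -
      \<comment> \<open>Translation by \<open>h\<close> preserves null sets of the group, so the
        exceptional set of \<open>x\<close> does not depend on \<open>h\<close>.\<close>
      have "AE g in m. f (act h (act g x)) = f' (act h (act g x))"
        using AE_plus[OF elim(2), of h] by (simp add: act_add)
      with elim(2) have ae: "AE g in m. indicat_real (F n) g *\<^sub>R (f (act h (act g x)) * cnj (f (act g x))) =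
          indicat_real (F n) g *\<^sub>R (f' (act h (act g x)) * cnj (f' (act g x)))"
        by eventually_elim simp
      have meas: "(\<lambda>g. u (act h (act g x)) * cnj (u (act g x))) \<in> borel_measurable m"
        if "u \<in> borel_measurable M" for u :: "'x \<Rightarrow> complex"
      proof -
        have "(\<lambda>y. u (act h y)) \<in> borel_measurable M"
          by (rule measurable_compose[OF _ that]) measurable
        then show ?thesis by (intro borel_measurable_times cnj_meas orbit_measurable that)
      qed
      from ae show ?thesis
        unfolding orbit_mean_def set_lebesgue_integral_def
        by (intro arg_cong2[where f = scaleR] refl integral_cong_AE borel_measurable_scaleR
            borel_measurable_indicator F_sets meas f f'_meas)
    qed
    with elim(1) show ?case by (simp add: eq_int)
  qed
qed

end

theorem lemma3p4:
  fixes m :: "'g::{topological_ab_group_add, t2_space, second_countable_topology} measure"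
    and act :: "'g \<Rightarrow> 'x::topological_space \<Rightarrow> 'x"
    and M :: "'x measure"
    and f :: "'x \<Rightarrow> complex"
    and F :: "nat \<Rightarrow> 'g set"
  assumes "locally_compact_space (euclidean :: 'g topology)"
    and "haar_measure m"
    and "compact (UNIV :: 'x set)"
    and "continuous_action act"
    and "sets M = sets borel"
    and "prob_space M"
    and "ergodic_measure act M"
    and "f \<in> L_infinity M"
    and "strong_folner_sequence m F"
    and "tempered m F"
  shows "\<exists>X'. X' \<in> sets M \<and> measure M X' = 1 \<and>
    (\<forall>x\<in>X'. \<forall>h.
       (\<lambda>n. (1 / measure m (F n)) *\<^sub>R
            (LINT g:F n|m. f (act (h + g) x) * cnj (f (act g x))))
         \<longlonglongrightarrow> (LINT y|M. f (act h y) * cnj (f y)) \<and>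
       (LINT y|M. f (act h y) * cnj (f y)) = L2_inner M (koopman act (- h) f) f)"
proof -
  interpret prob_space M by fact
  interpret folner_action M m act F
    using assms by unfold_locales (auto simp: ergodic_measure_def)
  have f: "f \<in> borel_measurable M" "esssup M (\<lambda>x. ereal (cmod (f x))) < \<infinity>"
    using assms(8) by (auto simp: L_infinity_def)
  \<comment> \<open>The essential supremum is an extended real: \<open>max r 0\<close> secures a
    nonnegative bound in the finite case, and 0 serves for the value minus infinity.\<close>
  obtain B where B: "B \<ge> 0" "esssup M (\<lambda>x. ereal (cmod (f x))) \<le> ereal B"
  proof (cases "esssup M (\<lambda>x. ereal (cmod (f x)))")
    case (real r)
    then show ?thesis using that[of "max r 0"] by simp
  qed (use f(2) that[of 0] in auto)
  have "AE x in M. ereal (cmod (f x)) \<le> esssup M (\<lambda>x. ereal (cmod (f x)))" by (rule esssup_AE)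
  then have "AE x in M. cmod (f x) \<le> B"
    by eventually_elim (use B(2) in \<open>metis ereal_less_eq(3) order_trans\<close>)
  from correlation_averages_essentially_bounded[OF f(1) this B(1)]
  obtain X' where X': "X' \<in> sets M" "prob X' = 1"
    "\<And>x. x \<in> X' \<Longrightarrow> \<forall>h. (\<lambda>n. avg n (\<lambda>y. f (act h y) * cnj (f y)) x) \<longlonglongrightarrow>
      (\<integral>y. f (act h y) * cnj (f y) \<partial>M)"
    by (rule AE_E_prob) blast
  show ?thesis
    using X' by (intro exI[of _ X']) (simp add: orbit_mean_def act_add L2_inner_def koopman_def)
qed

end
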